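(* Let $\mathfrak F$ be a free filter on $\mathbb N$ and $(a_n)_{n\in\mathbb N}\subset(1,\infty)$ be a sequence of reals. Then the following conditions are equivalent: (i) There is an $\mathfrak F$-basis of $\ell_1$ with continuous coordinate functionals whose partial sums operators $S_n$ satisfy $\|S_n\|=a_n$ for all $n\in\mathbb N$. (ii) There are an infinite-dimensional real Banach space $X$ and an $\mathfrak F$-basis of $X$ with continuous coordinate functionals whose partial sums operators $S_n$ satisfy $\|S_n\|=a_n$ for all $n\in\mathbb N$. (iii) The sequence $(a_n)_{n\in\mathbb N}$ is $(\mathfrak F,1)$-admissible, i.e. $\sum_{n\in I}a_n^{-1}=\infty$ for every $\mathfrak F$-stationary set $I\subset\mathbb N$.
   Context: All Banach spaces are real. A filter $\mathfrak F$ on $\mathbb N$ is a non-empty family of subsets of $\mathbb N$ with $\emptyset\notin\mathfrak F$, closed under finite intersections and supersets; it is free if it contains every subset of $\mathbb N$ with finite complement. A set $I\subset\mathbb N$ is $\mathfrak F$-stationary if $I\cap A\ne\emptyset$ for every $A\in\mathfrak F$. A sequence $(x_n)$ in a topological space is $\mathfrak F$-convergent to $x$ if $\{n\in\mathbb N:x_n\in U\}\in\mathfrak F$ for every neighborhood $U$ of $x$. $\mathfrak F$-basis: a sequence $(u_k)_{k\in\mathbb N}$ in a Banach space $X$ is an $\mathfrak F$-basis of $X$ if for every $x\in X$ there is a unique sequence of scalars $(c_k)$ such that the partial sums $\sum_{k=1}^n c_k u_k$ are $\mathfrak F$-convergent (in $n$) in norm to $x$. The coordinate functionals are $u_k^*:x\mapsto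 c_k$, and the partial sums operators are $S_n(x)=\sum_{k=1}^n u_k^*(x)u_k$; when the coordinate functionals are continuous, $\|S_n\|$ is the operator norm. *)

theory Defs
  imports "HOL-Analysis.Analysis" "HOL-Library.Function_Algebras"
begin

text \<open>
  Filters on the natural numbers are values \<open>F\<close> of the library type \<^typ>\<open>nat filter\<close>; a set \<open>A\<close>
  belongs to the filter iff \<^prop>\<open>eventually (\<lambda>n. n \<in> A) F\<close>.  The library type also contains the
  improper filter \<^term>\<open>bot\<close> (the one containing the empty set), which has to be excluded.

  Indices start at 0: the index \<open>n\<close> here is the index \<open>n + 1\<close> of the usual numbering
  1, 2, 3, ..., so that the \<open>n\<close>-th partial sum runs over \<open>k \<le> n\<close> and the first partial sum
  has one term.
\<close>

definition free_filter :: "nat filter \<Rightarrow> bool" where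
  "free_filter F \<longleftrightarrow> F \<noteq> bot \<and> (\<forall>A. finite (- A) \<longrightarrow> eventually (\<lambda>n. n \<in> A) F)"

definition stationary :: "nat filter \<Rightarrow> nat set \<Rightarrow> bool" where
  "stationary F I \<longleftrightarrow> (\<forall>A. eventually (\<lambda>n. n \<in> A) F \<longrightarrow> I \<inter> A \<noteq> {})"

definition admissible1 :: "nat filter \<Rightarrow> (nat \<Rightarrow> real) \<Rightarrow> bool" where
  "admissible1 F a \<longleftrightarrow>
     (\<forall>I. stationary F I \<longrightarrow> (\<Sum>\<^sub>\<infinity>n\<in>I. ennreal (inverse (a n))) = \<infinity>)"


text \<open>
  So that the existence of a Banach space can be asserted inside a formula, a normed space is
  given by a linear subspace \<open>V\<close> of a real vector space together with a norm \<open>N\<close> on \<open>V\<close>;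
  the values of \<open>N\<close> outside \<open>V\<close> are irrelevant.

  The ambient space used for an existential statement is the type \<^typ>\<open>nat \<Rightarrow> real\<close>.
  This loses nothing for spaces with an F-basis, since \<open>x \<mapsto> (u\<^sub>k\<^sup>*(x))\<^sub>k\<close> embeds such a space
  linearly into the real sequences, and the norm can be carried over.  Conversely, HOL has no
  existential quantifier over types, so the implication from the existence of a Banach space is
  additionally stated with the ambient space a free type variable.
\<close>

definition norm_on :: "'a::real_vector set \<Rightarrow> ('a \<Rightarrow> real) \<Rightarrow> bool" where
  "norm_on V N \<longleftrightarrow>
     (\<forall>x\<in>V. 0 \<le> N x \<and> (N x = 0 \<longleftrightarrow> x = 0)) \<and>
     (\<forall>c. \<forall>x\<in>V. N (c *\<^sub>R x) = \<bar>c\<bar> * N x) \<and>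
     (\<forall>x\<in>V. \<forall>y\<in>V. N (x + y) \<le> N x + N y)"

text \<open>
  The distance is cut off outside \<open>V\<close> because the locale \<^locale>\<open>Metric_space\<close> asks for
  non-negativity and symmetry on the whole type.
\<close>

definition norm_dist :: "'a::real_vector set \<Rightarrow> ('a \<Rightarrow> real) \<Rightarrow> 'a \<Rightarrow> 'a \<Rightarrow> real" where
  "norm_dist V N x y = (if x \<in> V \<and> y \<in> V then N (x - y) else 0)"

definition norm_topology :: "'a::real_vector set \<Rightarrow> ('a \<Rightarrow> real) \<Rightarrow> 'a topology" where
  "norm_topology V N = Metric_space.mtopology V (norm_dist V N)"

definition banach_space_on :: "'a::real_vector set \<Rightarrow> ('a \<Rightarrow> real) \<Rightarrow> bool" where
  "banach_space_on V N \<longleftrightarrow>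
     subspace V \<and> norm_on V N \<and> Metric_space.mcomplete V (norm_dist V N)"

definition infinite_dimensional :: "'a::real_vector set \<Rightarrow> bool" where
  "infinite_dimensional V \<longleftrightarrow> \<not> (\<exists>B. finite B \<and> V \<subseteq> span B)"

definition operator_norm :: "'a::real_vector set \<Rightarrow> ('a \<Rightarrow> real) \<Rightarrow> ('a \<Rightarrow> 'a) \<Rightarrow> real" where
  "operator_norm V N T = (SUP x\<in>{x \<in> V. N x \<le> 1}. N (T x))"


definition f_expansion ::
  "nat filter \<Rightarrow> 'a::real_vector set \<Rightarrow> ('a \<Rightarrow> real) \<Rightarrow> (nat \<Rightarrow> 'a) \<Rightarrow> 'a \<Rightarrow> (nat \<Rightarrow> real) \<Rightarrow> bool"
  where "f_expansion F V N u x c \<longleftrightarrow>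
     limitin (norm_topology V N) (\<lambda>n. \<Sum>k\<le>n. c k *\<^sub>R u k) x F"

definition f_basis ::
  "nat filter \<Rightarrow> 'a::real_vector set \<Rightarrow> ('a \<Rightarrow> real) \<Rightarrow> (nat \<Rightarrow> 'a) \<Rightarrow> bool" where
  "f_basis F V N u \<longleftrightarrow> (\<forall>k. u k \<in> V) \<and> (\<forall>x\<in>V. \<exists>!c. f_expansion F V N u x c)"

definition coord ::
  "nat filter \<Rightarrow> 'a::real_vector set \<Rightarrow> ('a \<Rightarrow> real) \<Rightarrow> (nat \<Rightarrow> 'a) \<Rightarrow> nat \<Rightarrow> 'a \<Rightarrow> real" where
  "coord F V N u k x = (THE c. f_expansion F V N u x c) k"

definition partial_sum_op ::
  "nat filter \<Rightarrow> 'a::real_vector set \<Rightarrow> ('a \<Rightarrow> real) \<Rightarrow> (nat \<Rightarrow> 'a) \<Rightarrow> nat \<Rightarrow> 'a \<Rightarrow> 'a" where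
  "partial_sum_op F V N u n x = (\<Sum>k\<le>n. coord F V N u k x *\<^sub>R u k)"

definition has_f_basis_with_norms ::
  "nat filter \<Rightarrow> (nat \<Rightarrow> real) \<Rightarrow> 'a::real_vector set \<Rightarrow> ('a \<Rightarrow> real) \<Rightarrow> bool" where
  "has_f_basis_with_norms F a V N \<longleftrightarrow>
     (\<exists>u. f_basis F V N u \<and>
          (\<forall>k. continuous_map (norm_topology V N) euclideanreal (coord F V N u k)) \<and>
          (\<forall>n. operator_norm V N (partial_sum_op F V N u n) = a n))"


text \<open>Pointwise real vector space structure on functions (addition is from the library).\<close>

instantiation "fun" :: (type, real_vector) real_vector
begin

definition scaleR_fun :: "real \<Rightarrow> ('a \<Rightarrow> 'b) \<Rightarrow> 'a \<Rightarrow> 'b" where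
  "scaleR_fun c f = (\<lambda>x. c *\<^sub>R f x)"

instance
  by standard (simp_all add: scaleR_fun_def fun_eq_iff scaleR_add_right scaleR_add_left)

end

definition ell1 :: "(nat \<Rightarrow> real) set" where
  "ell1 = {x. summable (\<lambda>n. \<bar>x n\<bar>)}"

definition ell1_norm :: "(nat \<Rightarrow> real) \<Rightarrow> real" where
  "ell1_norm x = (\<Sum>n. \<bar>x n\<bar>)"


text \<open>
  Every type of class \<^class>\<open>banach\<close> is a Banach space in the sense above, and its norm
  topology and operator norm are those of the library.
\<close>

lemma norm_dist_UNIV: "norm_dist UNIV norm = (dist :: 'a::real_normed_vector \<Rightarrow> 'a \<Rightarrow> real)"
  by (simp add: norm_dist_def fun_eq_iff dist_norm)

lemma norm_topology_UNIV: "norm_topology UNIV norm = (euclidean :: 'a::real_normed_vector topology)"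
  by (simp add: norm_topology_def norm_dist_UNIV)

lemma banach_space_on_UNIV: "banach_space_on (UNIV :: 'a::banach set) norm"
proof -
  have "Metric_space.mcomplete (UNIV :: 'a set) dist"
    by (simp add: complete_UNIV)
  then show ?thesis
    by (simp add: banach_space_on_def norm_on_def norm_dist_UNIV norm_triangle_ineq)
qed

lemma operator_norm_UNIV:
  fixes T :: "'a::real_normed_vector \<Rightarrow> 'a"
  assumes "bounded_linear T"
  shows "operator_norm UNIV norm T = onorm T"
proof -
  interpret T: bounded_linear T by fact
  have "(SUP x\<in>{x. norm x \<le> 1}. norm (T x)) = onorm T"
  proof (rule antisym)
    show "(SUP x\<in>{x. norm x \<le> 1}. norm (T x)) \<le> onorm T"
    proof (rule cSUP_least)
      show "{x :: 'a. norm x \<le> 1} \<noteq> {}"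
        by (auto intro!: exI[of _ 0])
      fix x :: 'a assume "x \<in> {x. norm x \<le> 1}"
      then show "norm (T x) \<le> onorm T"
        using mult_left_le[of "norm x" "onorm T"] onorm_pos_le[OF assms] onorm[OF assms, of x]
        by auto
    qed
    have bdd: "bdd_above ((\<lambda>x. norm (T x)) ` {x. norm x \<le> 1})"
    proof (rule bdd_aboveI2)
      fix x :: 'a assume "x \<in> {x. norm x \<le> 1}"
      then show "norm (T x) \<le> onorm T"
        using mult_left_le[of "norm x" "onorm T"] onorm_pos_le[OF assms] onorm[OF assms, of x]
        by auto
    qed
    show "onorm T \<le> (SUP x\<in>{x. norm x \<le> 1}. norm (T x))"
    proof (rule onorm_bound)
      have "norm (T 0) \<le> (SUP x\<in>{x. norm x \<le> 1}. norm (T x))"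
        by (rule cSUP_upper[OF _ bdd]) simp
      then show "0 \<le> (SUP x\<in>{x. norm x \<le> 1}. norm (T x))"
        by (simp add: T.zero)
      fix x :: 'a
      show "norm (T x) \<le> (SUP x\<in>{x. norm x \<le> 1}. norm (T x)) * norm x"
      proof (cases "x = 0")
        case False
        have "norm (T (x /\<^sub>R norm x)) \<le> (SUP x\<in>{x. norm x \<le> 1}. norm (T x))"
          by (rule cSUP_upper[OF _ bdd]) (use False in simp)
        then show ?thesis
          using False by (simp add: T.scaleR field_simps)
      qed (simp add: T.zero)
    qed
  qed
  then show ?thesis
    by (simp add: operator_norm_def)
qed

end

theory Submission
  imports Defs "HOL-Complex_Analysis.Conformal_Mappings"
begin

text \<open>
  \<^bold>\<open>From a basis to admissibility.\<close>  Suppose that the series of \<open>1 / a n\<close> converges on a stationary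
  set \<open>I\<close>.  As \<open>\<parallel>S n\<parallel> = a n\<close>, there are functionals \<open>\<phi> n = f n \<circ> S n\<close> of norm between \<open>a n / 2\<close> and
  \<open>a n\<close> with \<open>\<parallel>f n\<parallel> \<le> 1\<close> on the range of \<open>S n\<close>.  If a vector \<open>x\<close> of the unit ball satisfied
  \<open>|\<phi> n x| > 2\<close> for all large \<open>n\<close> in \<open>I\<close>, then \<open>S n x\<close> would stay away from \<open>x\<close> on a stationary set.
  The existence of such a vector says that the unit ball is not covered by the planks
  \<open>|\<phi> n x| \<le> 2\<close>, \<open>n \<in> I\<close> large, whose widths, of the order of \<open>1 / a n\<close>, have a small sum.

  Over the complex numbers a plank theorem with a constant has an easy proof: a point of the unit
  ball that maximises a weighted product of the moduli of the functionals does it, because by the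
  maximum modulus principle no factor can be too small there
  (\<open>norm_coefficient_le_of_product_bound\<close>, \<open>exists_linear_forms_ge_finite\<close>).  It applies to a real
  space as well, since the real and the imaginary part of a complex solution are two real vectors
  such that for each \<open>n\<close> at least one of them is far from the centre of the \<open>n\<close>-th plank, and two
  vectors are as good as one: the filter contains the intersection of the two sets on which their
  partial sums are close to them (\<open>admissible_of_norms\<close>).

  For infinitely many planks a compactness argument is needed.  Only combinations \<open>\<Sum>j. v j *\<^sub>R X j\<close>
  of vectors \<open>X j\<close> of the unit ball that almost norm the \<open>\<phi> j\<close> are considered, and \<open>v\<close> is restricted to
  the unit ball of a weighted \<open>\<ell>\<^sub>1\<close> whose weights tend to infinity.  That ball is compact for
  coordinatewise convergence, and the functionals are continuous on it (\<open>complex_plank\<close>).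

  \<^bold>\<open>From admissibility to a basis of \<open>\<ell>\<^sub>1\<close>.\<close>  Admissibility forces \<open>a n * |x (n + 1)|\<close> to tend to zero
  along the filter for every \<open>x\<close> in \<open>\<ell>\<^sub>1\<close> (\<open>eventually_scaled_coefficient_less\<close>).  So the coordinate
  projection onto the indices up to \<open>n\<close> may be perturbed by \<open>x \<mapsto> (a n * x (n + 1)) *\<^sub>R w n\<close> with a unit
  vector \<open>w n\<close> supported on these indices.  For a suitable choice of the \<open>w n\<close> the perturbed
  projections are the partial sums operators of a basis (\<open>zigzag_partial_sum\<close>), and their norms are
  exactly \<open>a n\<close>.
\<close>


section \<open>A weighted unit ball and its linear forms\<close>

text \<open>
  The closed unit ball of a weighted complex \<open>\<ell>\<^sub>1\<close>, written with finite sums so that it is visibly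
  closed under coordinatewise limits.  Weights tending to infinity make it small: the tails of its
  elements are then uniformly small in the unweighted \<open>\<ell>\<^sub>1\<close>-norm.
\<close>

definition weighted_ball :: "(nat \<Rightarrow> real) \<Rightarrow> (nat \<Rightarrow> complex) set" where
  "weighted_ball \<rho> = {v. \<forall>n. (\<Sum>j<n. \<rho> j * cmod (v j)) \<le> 1}"

definition linear_form :: "(nat \<Rightarrow> complex) \<Rightarrow> (nat \<Rightarrow> complex) \<Rightarrow> complex" where
  "linear_form b v = (\<Sum>j. b j * v j)"

text \<open>
  The maximum modulus principle, read as a lower bound on the circle.  This is where complex scalars
  enter: the analogous statement for polynomials on a real interval fails.
\<close>

lemma exists_circle_point_norm_ge:
  assumes "f holomorphic_on UNIV" and "0 < R"
  obtains z where "cmod z = R" and "cmod (f 0) \<le> cmod (f z)"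
proof -
  have cont: "continuous_on UNIV f"
    using assms(1) holomorphic_on_imp_continuous_on by blast
  have "\<exists>z\<in>sphere 0 R. \<forall>y\<in>sphere 0 R. cmod (f y) \<le> cmod (f z)"
    using assms(2)
    by (intro continuous_attains_sup compact_sphere continuous_on_norm continuous_on_subset[OF cont]) auto
  then obtain z where z: "cmod z = R" "\<And>y. cmod y = R \<Longrightarrow> cmod (f y) \<le> cmod (f z)"
    by auto
  have "cmod (f 0) \<le> cmod (f z)"
  proof (rule maximum_modulus_frontier[where f = f and S = "cball 0 R" and \<xi> = 0])
    show "f holomorphic_on interior (cball 0 R)" "continuous_on (closure (cball 0 R)) f"
      using assms(1) cont by (blast intro: holomorphic_on_subset continuous_on_subset)+
    show "cmod (f y) \<le> cmod (f z)" if "y \<in> frontier (cball 0 R)" for y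
      using that assms(2) by (intro z(2)) simp
  qed (use assms(2) in auto)
  with z(1) that show ?thesis by blast
qed

lemma weighted_ball_summable:
  assumes v: "v \<in> weighted_ball \<rho>" and \<rho>: "\<And>j. 1 \<le> \<rho> j"
  shows "summable (\<lambda>j. \<rho> j * cmod (v j))" "(\<Sum>j. \<rho> j * cmod (v j)) \<le> 1"
    "summable (\<lambda>j. cmod (v j))" "(\<Sum>j. cmod (v j)) \<le> 1"
proof -
  have nonneg: "0 \<le> \<rho> j * cmod (v j)" for j
    using \<rho>[of j] by simp
  have le: "cmod (v j) \<le> \<rho> j * cmod (v j)" for j
    using mult_right_mono[OF \<rho>[of j], of "cmod (v j)"] by simp
  show 1: "summable (\<lambda>j. \<rho> j * cmod (v j))"
    using v nonneg by (intro summableI_nonneg_bounded[of _ 1]) (auto simp: weighted_ball_def)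
  show 2: "(\<Sum>j. \<rho> j * cmod (v j)) \<le> 1"
    using v by (intro suminf_le_const 1) (auto simp: weighted_ball_def)
  show 3: "summable (\<lambda>j. cmod (v j))"
    by (rule summable_comparison_test'[OF 1]) (use le in auto)
  show "(\<Sum>j. cmod (v j)) \<le> 1"
    using suminf_le[OF le 3 1] 2 by simp
qed

lemma summable_linear_form:
  assumes "summable (\<lambda>j. cmod (v j))" and b: "\<And>j. cmod (b j) \<le> 1"
  shows "summable (\<lambda>j. b j * v j)"
  by (rule summable_comparison_test'[OF assms(1)])
    (use mult_right_mono[OF b] in \<open>auto simp: norm_mult\<close>)

lemma closed_weighted_ball: "closed (weighted_ball \<rho>)"
  unfolding weighted_ball_def
  by (intro closed_Collect_all closed_Collect_le continuous_intros
      continuous_on_subset[OF continuous_on_product_coordinates]) auto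

text \<open>
  Compactness is meant for the topology of coordinatewise convergence; the ball is a closed part of a
  product of discs, so Tychonoff's theorem applies.
\<close>

lemma compact_weighted_ball:
  assumes "\<And>j. 1 \<le> \<rho> j"
  shows "compact (weighted_ball \<rho>)"
proof -
  have "compactin (product_topology (\<lambda>i. euclidean) UNIV) (\<Pi>\<^sub>E j\<in>(UNIV::nat set). cball (0::complex) 1)"
    by (subst compactin_PiE) auto
  then have "compact (\<Pi>\<^sub>E j\<in>(UNIV::nat set). cball (0::complex) 1)"
    by (simp add: euclidean_product_topology)
  moreover have "weighted_ball \<rho> \<subseteq> (\<Pi>\<^sub>E j\<in>(UNIV::nat set). cball (0::complex) 1)"
  proof
    fix v assume v: "v \<in> weighted_ball \<rho>"
    have "cmod (v j) \<le> 1" for j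
      using sum_le_suminf[OF weighted_ball_summable(3)[OF v assms], of "{j}"]
        weighted_ball_summable(4)[OF v assms] by auto
    then show "v \<in> (\<Pi>\<^sub>E j\<in>(UNIV::nat set). cball (0::complex) 1)"
      by auto
  qed
  ultimately show ?thesis
    using closed_weighted_ball compact_Int_closed[of _ "weighted_ball \<rho>"]
    by (metis Int_absorb1)
qed

text \<open>
  A form with bounded coefficients is in general discontinuous for coordinatewise convergence.  On the
  weighted ball it is continuous: since \<open>\<rho> j\<close> tends to infinity, its partial sums converge uniformly.
\<close>

lemma continuous_on_linear_form:
  assumes b: "\<And>j. cmod (b j) \<le> 1" and \<rho>: "\<And>j. 1 \<le> \<rho> j"
    and lim: "filterlim \<rho> at_top sequentially"
  shows "continuous_on (weighted_ball \<rho>) (linear_form b)"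
proof (rule uniform_limit_theorem)
  show "\<forall>\<^sub>F n in sequentially. continuous_on (weighted_ball \<rho>) (\<lambda>v. \<Sum>j<n. b j * v j)"
    by (intro always_eventually allI continuous_intros
        continuous_on_subset[OF continuous_on_product_coordinates]) auto
  show "uniform_limit (weighted_ball \<rho>) (\<lambda>n v. \<Sum>j<n. b j * v j) (linear_form b) sequentially"
    unfolding uniform_limit_iff
  proof (intro allI impI)
    fix e :: real assume e: "0 < e"
    have "\<forall>\<^sub>F j in sequentially. 2 / e \<le> \<rho> j"
      using lim by (auto simp: filterlim_at_top)
    then obtain n0 where n0: "\<And>j. n0 \<le> j \<Longrightarrow> 2 / e \<le> \<rho> j"
      by (auto simp: eventually_sequentially)
    have "dist (\<Sum>j<n. b j * v j) (linear_form b v) < e"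
      if n: "n0 \<le> n" and v: "v \<in> weighted_ball \<rho>" for n v
    proof -
      note s = weighted_ball_summable[OF v \<rho>]
      have sb: "summable (\<lambda>j. b j * v j)"
        by (rule summable_linear_form[OF s(3) b])
      have bnd: "norm (b (j + n) * v (j + n)) \<le> e / 2 * (\<rho> (j + n) * cmod (v (j + n)))" for j
      proof -
        have "norm (b (j + n) * v (j + n)) \<le> cmod (v (j + n))"
          using mult_right_mono[OF b] by (auto simp: norm_mult)
        also have "\<dots> \<le> e / 2 * \<rho> (j + n) * cmod (v (j + n))"
        proof -
          have "1 \<le> e / 2 * \<rho> (j + n)"
            using n0[of "j + n"] n e by (simp add: field_simps)
          then show ?thesis
            using mult_right_mono[of 1 "e / 2 * \<rho> (j + n)" "cmod (v (j + n))"] by simp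
        qed
        finally show ?thesis by (simp add: mult.assoc)
      qed
      have st: "summable (\<lambda>j. e / 2 * (\<rho> (j + n) * cmod (v (j + n))))"
        by (intro summable_mult summable_ignore_initial_segment s)
      have "dist (\<Sum>j<n. b j * v j) (linear_form b v) = norm (\<Sum>j. b (j + n) * v (j + n))"
        unfolding linear_form_def dist_norm
        by (subst suminf_minus_initial_segment[OF sb]) (simp add: norm_minus_commute)
      also have "\<dots> \<le> (\<Sum>j. e / 2 * (\<rho> (j + n) * cmod (v (j + n))))"
        by (rule norm_suminf_le[OF bnd st])
      also have "\<dots> = e / 2 * (\<Sum>j. \<rho> (j + n) * cmod (v (j + n)))"
        by (intro suminf_mult summable_ignore_initial_segment s)
      also have "(\<Sum>j. \<rho> (j + n) * cmod (v (j + n))) \<le> 1"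
      proof -
        have "0 \<le> (\<Sum>j<n. \<rho> j * cmod (v j))"
          by (intro sum_nonneg mult_nonneg_nonneg order_trans[OF zero_le_one \<rho>] norm_ge_zero)
        then show ?thesis
          using suminf_minus_initial_segment[OF s(1), of n] s(2) by simp
      qed
      finally show ?thesis using e by simp
    qed
    then show "\<forall>\<^sub>F n in sequentially. \<forall>v\<in>weighted_ball \<rho>. dist (\<Sum>j<n. b j * v j) (linear_form b v) < e"
      by (auto simp: eventually_sequentially)
  qed
qed simp

section \<open>Maximising a product of linear forms\<close>

text \<open>
  Let \<open>h\<close> be the product of all the factors except the \<open>j\<close>-th one.  The maximum modulus principle gives a
  point \<open>z\<close> of the circle with \<open>|h z| \<ge> |h 0|\<close>.  There the growth bound can only be used up by the
  \<open>j\<close>-th factor, so \<open>|A j + z * \<beta> j| \<le> e * |A j|\<close>, which bounds the slope of this factor by its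
  value at the centre.
\<close>

lemma norm_coefficient_le_of_product_bound:
  fixes A \<beta> :: "nat \<Rightarrow> complex" and m :: "nat \<Rightarrow> nat"
  assumes nz: "\<And>i. i < n \<Longrightarrow> A i \<noteq> 0" and j: "j < n" "0 < m j" and R: "0 < R"
    and bound: "\<And>z. cmod z = R \<Longrightarrow>
      cmod (\<Prod>i<n. (A i + z * \<beta> i) ^ m i) \<le> exp (real (m j)) * cmod (\<Prod>i<n. A i ^ m i)"
  shows "R * cmod (\<beta> j) \<le> 4 * cmod (A j)"
proof -
  define h where "h z = (\<Prod>i\<in>{..<n} - {j}. (A i + z * \<beta> i) ^ m i)" for z
  have split: "(\<Prod>i<n. (A i + z * \<beta> i) ^ m i) = (A j + z * \<beta> j) ^ m j * h z" for z
    unfolding h_def using j by (subst prod.remove[of _ j]) auto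
  have "h holomorphic_on UNIV"
    unfolding h_def by (intro holomorphic_intros)
  then obtain z where z: "cmod z = R" and hz: "cmod (h 0) \<le> cmod (h z)"
    using exists_circle_point_norm_ge R by blast
  have h0: "0 < cmod (h 0)"
    using nz by (simp add: h_def)
  have "cmod (A j + z * \<beta> j) ^ m j * cmod (h 0) \<le> cmod (A j + z * \<beta> j) ^ m j * cmod (h z)"
    using hz by (intro mult_left_mono) auto
  also have "\<dots> \<le> exp (real (m j)) * (cmod (A j) ^ m j * cmod (h 0))"
    using bound[OF z] split[of z] split[of 0] by (simp add: norm_mult norm_power)
  finally have "cmod (A j + z * \<beta> j) ^ m j \<le> (exp 1 * cmod (A j)) ^ m j"
    using h0 by (simp add: power_mult_distrib exp_of_nat_mult[symmetric])
  then have "cmod (A j + z * \<beta> j) \<le> exp 1 * cmod (A j)"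
    using j(2) by (metis gr0_conv_Suc power_le_imp_le_base norm_ge_zero exp_ge_zero mult_nonneg_nonneg)
  also have "\<dots> \<le> 3 * cmod (A j)"
    by (intro mult_right_mono exp_le) auto
  finally have "cmod (A j + z * \<beta> j) \<le> 3 * cmod (A j)" .
  moreover have "R * cmod (\<beta> j) \<le> cmod (A j + z * \<beta> j) + cmod (A j)"
    using norm_triangle_ineq4[of "A j + z * \<beta> j" "A j"] z by (simp add: norm_mult)
  ultimately show ?thesis by simp
qed

text \<open>
  Dividing by \<open>max s 1\<close> rather than by \<open>s\<close> avoids a case distinction for \<open>s = 0\<close>.
\<close>

lemma scale_mem_weighted_ball:
  assumes "s \<ge> 0" "\<And>n. (\<Sum>j<n. \<rho> j * cmod (v j)) \<le> s"
  shows "(\<lambda>j. v j / of_real (max s 1)) \<in> weighted_ball \<rho>"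
proof -
  have "(\<Sum>j<n. \<rho> j * cmod (v j / of_real (max s 1))) = (\<Sum>j<n. \<rho> j * cmod (v j)) / max s 1" for n
    by (simp add: norm_divide sum_divide_distrib)
  moreover have "(\<Sum>j<n. \<rho> j * cmod (v j)) / max s 1 \<le> 1" for n
    using assms(2)[of n] by (simp add: field_simps)
  ultimately show ?thesis by (simp add: weighted_ball_def)
qed

lemma linear_form_divide:
  assumes "summable (\<lambda>j. b j * v j)"
  shows "linear_form b (\<lambda>j. v j / c) = linear_form b v / c"
  using suminf_divide[OF assms, of c] by (simp add: linear_form_def)

text \<open>The curve \<open>t \<mapsto> (1, t, t\<^sup>2, \<dots>)\<close> meets each hyperplane only finitely often.\<close>

lemma exists_nonzero_linear_forms:
  fixes b :: "nat \<Rightarrow> nat \<Rightarrow> complex"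
  assumes diag: "\<And>i. i < n \<Longrightarrow> b i i \<noteq> 0"
  obtains v where "v \<in> weighted_ball \<rho>" and "\<And>i. i < n \<Longrightarrow> linear_form (b i) v \<noteq> 0"
proof -
  define p where "p i = (\<Sum>j<n. monom (b i j) j)" for i
  have "p i \<noteq> 0" if "i < n" for i
  proof
    assume "p i = 0"
    then have "coeff (p i) i = 0" by simp
    then show False
      using that diag[OF that] by (simp add: p_def coeff_sum)
  qed
  then have "finite (\<Union>i<n. {t. poly (p i) t = 0})"
    by (auto intro: poly_roots_finite)
  then obtain t where t: "t \<notin> (\<Union>i<n. {t. poly (p i) t = 0})"
    using ex_new_if_finite infinite_UNIV_char_0 by blast
  define w where "w j = (if j < n then t ^ j else 0)" for j
  have sums: "(\<lambda>j. c j * w j) sums (\<Sum>j<n. c j * w j)" for c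
    by (rule sums_finite) (auto simp: w_def)
  have form: "linear_form c w = (\<Sum>j<n. c j * w j)" for c
    using sums_unique[OF sums[of c]] by (simp add: linear_form_def)
  have nz: "linear_form (b i) w \<noteq> 0" if "i < n" for i
    using t that by (auto simp: form w_def p_def poly_sum poly_monom)
  define s where "s = (\<Sum>j<n. \<bar>\<rho> j\<bar> * cmod (w j))"
  have "(\<Sum>j<k. \<rho> j * cmod (w j)) \<le> s" for k
  proof -
    have "(\<Sum>j<k. \<rho> j * cmod (w j)) = (\<Sum>j\<in>{..<k} \<inter> {..<n}. \<rho> j * cmod (w j))"
      by (rule sum.mono_neutral_right) (auto simp: w_def)
    also have "\<dots> \<le> (\<Sum>j\<in>{..<k} \<inter> {..<n}. \<bar>\<rho> j\<bar> * cmod (w j))"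
      by (intro sum_mono mult_right_mono) auto
    also have "\<dots> \<le> s"
      unfolding s_def by (rule sum_mono2) auto
    finally show ?thesis .
  qed
  then have "(\<lambda>j. w j / of_real (max s 1)) \<in> weighted_ball \<rho>"
    by (intro scale_mem_weighted_ball) (auto simp: s_def intro: sum_nonneg)
  moreover have "linear_form (b i) (\<lambda>j. w j / of_real (max s 1)) \<noteq> 0" if "i < n" for i
    using nz[OF that] sums_summable[OF sums] by (subst linear_form_divide) (auto simp: max_def)
  ultimately show ?thesis using that by blast
qed

text \<open>
  The first part is needed separately because \<^const>\<open>suminf\<close> of a divergent series carries no
  information.
\<close>

lemma linear_form_perturb:
  assumes "summable (\<lambda>j. b j * v j)"
  shows "summable (\<lambda>k. b k * (v(j := v j + z)) k)"
    and "linear_form b (v(j := v j + z)) = linear_form b v + z * b j"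
proof -
  have 1: "(\<lambda>k. if k = j then z * b k else 0) sums (z * b j)"
    by (rule sums_single)
  have "(\<lambda>k. b k * v k + (if k = j then z * b k else 0)) sums (linear_form b v + z * b j)"
    unfolding linear_form_def by (intro sums_add summable_sums assms 1)
  moreover have "(\<lambda>k. b k * v k + (if k = j then z * b k else 0)) = (\<lambda>k. b k * (v(j := v j + z)) k)"
    by (auto simp: algebra_simps)
  ultimately have "(\<lambda>k. b k * (v(j := v j + z)) k) sums (linear_form b v + z * b j)"
    by simp
  then show "summable (\<lambda>k. b k * (v(j := v j + z)) k)"
    and "linear_form b (v(j := v j + z)) = linear_form b v + z * b j"
    by (auto simp: linear_form_def sums_iff)
qed

text \<open>
  The point \<open>v\<close> maximises \<open>\<Prod>i<n. |linear_form (b i) v| ^ m i\<close> on the weighted ball.  Moving \<open>v\<close> by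
  \<open>z\<close> in the \<open>j\<close>-th coordinate leaves the ball by a factor of at most \<open>1 + \<rho> j * |z|\<close>, so by
  homogeneity the product grows by at most the \<open>M\<close>-th power of this factor.  On the circle of radius
  \<open>R = m j / (M * \<rho> j)\<close> that is at most \<open>exp (m j)\<close>, and the previous estimate for products shows
  that the \<open>j\<close>-th form, whose slope is at least \<open>1/2\<close>, cannot be much smaller than \<open>R\<close> at \<open>v\<close>.
\<close>

lemma exists_linear_forms_ge_finite:
  fixes b :: "nat \<Rightarrow> nat \<Rightarrow> complex" and m :: "nat \<Rightarrow> nat"
  assumes b: "\<And>i j. cmod (b i j) \<le> 1" and diag: "\<And>i. 1/2 \<le> cmod (b i i)"
    and \<rho>: "\<And>j. 1 \<le> \<rho> j" and lim: "filterlim \<rho> at_top sequentially"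
    and m: "\<And>i. i < n \<Longrightarrow> 0 < m i" and M: "M = (\<Sum>i<n. m i)"
  obtains v where "v \<in> weighted_ball \<rho>"
    and "\<And>j. j < n \<Longrightarrow> real (m j) / (8 * real M * \<rho> j) \<le> cmod (linear_form (b j) v)"
proof -
  define P where "P v = (\<Prod>i<n. linear_form (b i) v ^ m i)" for v
  have nz: "b i i \<noteq> 0" for i
    using diag[of i] by auto
  have "continuous_on (weighted_ball \<rho>) (\<lambda>v. cmod (P v))"
    unfolding P_def by (intro continuous_intros continuous_on_linear_form b \<rho> lim)
  moreover obtain v0 where v0: "v0 \<in> weighted_ball \<rho>" "\<And>i. i < n \<Longrightarrow> linear_form (b i) v0 \<noteq> 0"
    using exists_nonzero_linear_forms[of n b \<rho>] nz by blast
  ultimately obtain v where v: "v \<in> weighted_ball \<rho>"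
    and max: "\<And>y. y \<in> weighted_ball \<rho> \<Longrightarrow> cmod (P y) \<le> cmod (P v)"
    using continuous_attains_sup[OF compact_weighted_ball[of \<rho>]] \<rho> by blast
  have "0 < cmod (P v0)"
    using v0(2) by (simp add: P_def)
  then have "P v \<noteq> 0"
    using max[OF v0(1)] by auto
  then have A: "linear_form (b i) v \<noteq> 0" if "i < n" for i
    using that m[OF that] by (auto simp: P_def)
  have sm: "summable (\<lambda>k. b i k * v k)" for i
    by (intro summable_linear_form weighted_ball_summable(3)[OF v] \<rho> b)
  show ?thesis
  proof (rule that[OF v])
    fix j assume j: "j < n"
    have Mpos: "0 < M"
      using M j m[OF j] by (metis finite_lessThan gr0I lessThan_iff less_numeral_extra(3) sum_eq_0_iff)
    \<comment> \<open>The radius balances the growth: \<open>(1 + \<rho> j * R) ^ M \<le> exp (m j)\<close>.\<close>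
    define R where "R = real (m j) / (real M * \<rho> j)"
    have \<rho>j: "0 < \<rho> j" using \<rho>[of j] by simp
    have R: "0 < R"
      using Mpos \<rho>j m[OF j] by (simp add: R_def)
    have "R * cmod (b j j) \<le> 4 * cmod (linear_form (b j) v)"
    proof (rule norm_coefficient_le_of_product_bound[where m = m and n = n and
            A = "\<lambda>i. linear_form (b i) v" and \<beta> = "\<lambda>i. b i j"])
      fix z assume z: "cmod z = R"
      define s where "s = 1 + \<rho> j * R"
      have s1: "1 \<le> s" using \<rho>j R by (simp add: s_def)
      define y where "y = v(j := v j + z)"
      have "(\<Sum>k<N. \<rho> k * cmod (y k)) \<le> s" for N
      proof -
        have "(\<Sum>k<N. \<rho> k * cmod (y k)) \<le> (\<Sum>k<N. \<rho> k * cmod (v k) + (if k = j then \<rho> j * R else 0))"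
        proof (rule sum_mono)
          fix k
          have "\<rho> j * cmod (v j + z) \<le> \<rho> j * (cmod (v j) + R)"
            using norm_triangle_ineq[of "v j" z] z \<rho>j by (intro mult_left_mono) auto
          then show "\<rho> k * cmod (y k) \<le> \<rho> k * cmod (v k) + (if k = j then \<rho> j * R else 0)"
            by (auto simp: y_def algebra_simps)
        qed
        also have "\<dots> \<le> 1 + \<rho> j * R"
          unfolding sum.distrib
          by (intro add_mono) (use v \<rho>j R in \<open>auto simp: weighted_ball_def\<close>)
        finally show ?thesis by (simp add: s_def)
      qed
      then have mem: "(\<lambda>k. y k / of_real s) \<in> weighted_ball \<rho>"
        using scale_mem_weighted_ball[of s \<rho> y] s1 by (simp add: max_def split: if_splits)
      have form: "linear_form (b i) (\<lambda>k. y k / of_real s) = (linear_form (b i) v + z * b i j) / of_real s" for i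
        using linear_form_perturb[OF sm[of i], of j z] linear_form_divide[of "b i" y "of_real s"]
        by (simp add: y_def)
      have "cmod (P (\<lambda>k. y k / of_real s)) \<le> cmod (P v)"
        using mem by (rule max)
      moreover have "P (\<lambda>k. y k / of_real s) = (\<Prod>i<n. (linear_form (b i) v + z * b i j) ^ m i) / of_real s ^ M"
        unfolding P_def form M by (simp add: power_divide prod_dividef power_sum)
      ultimately have "cmod (\<Prod>i<n. (linear_form (b i) v + z * b i j) ^ m i) \<le> s ^ M * cmod (P v)"
        using s1 by (simp add: norm_divide norm_power divide_simps mult.commute)
      also have "s ^ M \<le> exp (\<rho> j * R) ^ M"
        using s1 by (intro power_mono) (auto simp: s_def exp_ge_add_one_self)
      also have "exp (\<rho> j * R) ^ M = exp (real (m j))"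
        using \<rho>j Mpos by (simp add: exp_of_nat_mult[symmetric] R_def)
      finally show "cmod (\<Prod>i<n. (linear_form (b i) v + z * b i j) ^ m i)
          \<le> exp (real (m j)) * cmod (\<Prod>i<n. linear_form (b i) v ^ m i)"
        by (simp add: P_def mult_right_mono)
    qed (use A j m R in auto)
    moreover have "R * (1/2) \<le> R * cmod (b j j)"
      using R diag by (intro mult_left_mono) auto
    ultimately show "real (m j) / (8 * real M * \<rho> j) \<le> cmod (linear_form (b j) v)"
      by (simp add: R_def)
  qed
qed

section \<open>A plank theorem over the complex numbers\<close>

text \<open>
  A summable sequence stays summable after multiplication by suitable weights tending to infinity.
  The choice \<open>\<rho> n = 1 / sqrt (r n)\<close> with the tails \<open>r n\<close> of the series works because
  \<open>\<tau> n / sqrt (r n) \<le> 2 * (sqrt (r n) - sqrt (r (n + 1)))\<close> telescopes.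
\<close>

lemma exists_unbounded_weights:
  fixes \<tau> :: "nat \<Rightarrow> real"
  assumes pos: "\<And>n. 0 < \<tau> n" and sm: "summable \<tau>" and le1: "suminf \<tau> \<le> 1"
  obtains \<rho> where "\<And>n. 1 \<le> \<rho> n" and "filterlim \<rho> at_top sequentially"
    and "\<And>N. (\<Sum>n<N. \<tau> n * \<rho> n) \<le> 2"
proof -
  define r where "r n = suminf \<tau> - (\<Sum>k<n. \<tau> k)" for n
  have r_pos: "0 < r n" for n
    using sum_less_suminf[OF sm, of n] pos by (simp add: r_def)
  have r_le: "r n \<le> 1" for n
    using le1 sum_nonneg[of "{..<n}" \<tau>] pos by (simp add: r_def less_imp_le)
  have r_Suc: "r (Suc n) = r n - \<tau> n" for n
    by (simp add: r_def)
  have r_lim: "r \<longlonglongrightarrow> 0"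
    unfolding r_def using tendsto_diff[OF tendsto_const summable_LIMSEQ[OF sm], of "suminf \<tau>"] by simp
  have step: "\<tau> n * (1 / sqrt (r n)) \<le> 2 * (sqrt (r n) - sqrt (r (Suc n)))" for n
  proof -
    have "\<tau> n = (sqrt (r n) - sqrt (r (Suc n))) * (sqrt (r n) + sqrt (r (Suc n)))"
      using r_pos[of n] r_pos[of "Suc n"] by (simp add: r_Suc algebra_simps)
    also have "\<dots> \<le> (sqrt (r n) - sqrt (r (Suc n))) * (2 * sqrt (r n))"
      using pos[of n] r_Suc[of n] by (intro mult_left_mono) auto
    finally show ?thesis
      using r_pos[of n] by (simp add: field_simps)
  qed
  show ?thesis
  proof
    show "1 \<le> 1 / sqrt (r n)" for n
      using r_pos[of n] r_le[of n] by (simp add: field_simps)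
    have "filterlim (\<lambda>n. sqrt (r n)) (at_right 0) sequentially"
      unfolding filterlim_at using tendsto_real_sqrt[OF r_lim] r_pos
      by (auto simp: less_imp_neq[OF r_pos, symmetric])
    then show "filterlim (\<lambda>n. 1 / sqrt (r n)) at_top sequentially"
      using filterlim_compose[OF filterlim_inverse_at_top_right] by (simp add: inverse_eq_divide)
    show "(\<Sum>n<N. \<tau> n * (1 / sqrt (r n))) \<le> 2" for N
    proof -
      have "(\<Sum>n<N. \<tau> n * (1 / sqrt (r n))) \<le> (\<Sum>n<N. 2 * (sqrt (r n) - sqrt (r (Suc n))))"
        by (intro sum_mono step)
      also have "\<dots> = 2 * (sqrt (r 0) - sqrt (r N))"
        by (simp only: sum_distrib_left[symmetric] sum_lessThan_telescope'[of "\<lambda>n. sqrt (r n)"])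
      also have "\<dots> \<le> 2"
      proof -
        have le: "2 * (p - q) \<le> 2" if "p \<le> 1" "0 \<le> q" for p q :: real
          using that by simp
        show ?thesis
          by (rule le) (use r_le[of 0] r_pos[of N] in auto)
      qed
      finally show ?thesis .
    qed
  qed
qed

text \<open>
  A plank theorem over the complex numbers: planks \<open>|linear_form (b j) v| < \<tau> j / 24\<close> of small total
  width do not cover the unit ball of complex \<open>\<ell>\<^sub>1\<close>.  For finitely many planks this is
  \<open>exists_linear_forms_ge_finite\<close> with integers \<open>m j\<close> nearly proportional to \<open>\<tau> j * \<rho> j\<close>: the weight
  \<open>\<rho> j\<close> lost there in the denominator is regained in the numerator, so the bound is independent of
  \<open>n\<close>.  The passage to all \<open>j\<close> uses that the weighted ball is compact and the forms are continuous
  on it; making both true is the purpose of the weights.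
\<close>

lemma complex_plank:
  fixes b :: "nat \<Rightarrow> nat \<Rightarrow> complex" and \<tau> :: "nat \<Rightarrow> real"
  assumes b: "\<And>i j. cmod (b i j) \<le> 1" and diag: "\<And>i. 1/2 \<le> cmod (b i i)"
    and \<tau>: "\<And>n. 0 < \<tau> n" "summable \<tau>" "suminf \<tau> \<le> 1"
  obtains v where "summable (\<lambda>j. cmod (v j))" and "(\<Sum>j. cmod (v j)) \<le> 1"
    and "\<And>j. \<tau> j / 24 \<le> cmod (\<Sum>k. b j k * v k)"
proof -
  obtain \<rho> where \<rho>: "\<And>n. 1 \<le> \<rho> n" and lim: "filterlim \<rho> at_top sequentially"
    and le2: "\<And>N. (\<Sum>n<N. \<tau> n * \<rho> n) \<le> 2"
    using exists_unbounded_weights[OF \<tau>] by blast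
  have \<rho>pos: "0 < \<rho> j" for j
    using \<rho>[of j] by simp
  have fin: "\<exists>v\<in>weighted_ball \<rho>. \<forall>j<n. \<tau> j / 24 \<le> cmod (linear_form (b j) v)" if n: "0 < n" for n
  proof -
    define m where "m i = nat \<lceil>real n * (\<tau> i * \<rho> i)\<rceil>" for i
    have x: "0 < real n * (\<tau> i * \<rho> i)" for i
      using n \<tau>(1) \<rho>pos by simp
    have m: "0 < m i" "real n * (\<tau> i * \<rho> i) \<le> real (m i)" "real (m i) \<le> real n * (\<tau> i * \<rho> i) + 1" for i
      using x[of i] unfolding m_def by linarith+
    define M where "M = (\<Sum>i<n. m i)"
    have "real M \<le> (\<Sum>i<n. real n * (\<tau> i * \<rho> i) + 1)"
      unfolding M_def of_nat_sum by (intro sum_mono m)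
    also have "\<dots> = real n * (\<Sum>i<n. \<tau> i * \<rho> i) + real n"
      by (simp add: sum.distrib sum_distrib_left)
    also have "\<dots> \<le> real n * 2 + real n"
      by (intro add_mono mult_left_mono le2) auto
    finally have M: "real M \<le> 3 * real n" by simp
    have Mpos: "0 < M"
      using m(1) n unfolding M_def by (intro sum_pos) auto
    obtain v where v: "v \<in> weighted_ball \<rho>"
      and ge: "\<And>j. j < n \<Longrightarrow> real (m j) / (8 * real M * \<rho> j) \<le> cmod (linear_form (b j) v)"
      using exists_linear_forms_ge_finite[where b = b and m = m and n = n, OF b diag \<rho> lim m(1) M_def] by blast
    have "\<tau> j / 24 \<le> real (m j) / (8 * real M * \<rho> j)" for j
    proof -
      have "\<tau> j / 24 = real n * (\<tau> j * \<rho> j) / (8 * (3 * real n) * \<rho> j)"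
        using n \<rho>pos[of j] by simp
      also have "\<dots> \<le> real (m j) / (8 * real M * \<rho> j)"
        using m(2)[of j] M Mpos \<rho>pos[of j] by (intro frac_le mult_right_mono mult_left_mono) auto
      finally show ?thesis .
    qed
    with v ge show ?thesis by (meson order_trans)
  qed
  define C where "C i = {v \<in> weighted_ball \<rho>. \<tau> i / 24 \<le> cmod (linear_form (b i) v)}" for i
  have closed: "closed (C i)" for i
    unfolding C_def
    by (intro continuous_on_closed_Collect_le continuous_intros continuous_on_linear_form b \<rho> lim
        closed_weighted_ball)
  have fip: "weighted_ball \<rho> \<inter> (\<Inter>i\<in>J. C i) \<noteq> {}" if J: "finite J" for J
  proof -
    obtain n where n: "J \<subseteq> {..<n}"
      using finite_nat_bounded[OF J] by blast
    obtain v where v: "v \<in> weighted_ball \<rho>"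
      "\<forall>j<Suc n. \<tau> j / 24 \<le> cmod (linear_form (b j) v)"
      using fin[of "Suc n"] by blast
    then have "v \<in> weighted_ball \<rho> \<inter> (\<Inter>i\<in>J. C i)"
      using n by (auto simp: C_def)
    then show ?thesis by blast
  qed
  have "weighted_ball \<rho> \<inter> (\<Inter>i\<in>UNIV. C i) \<noteq> {}"
    by (rule compact_imp_fip_image[OF compact_weighted_ball[OF \<rho>] closed fip])
  then obtain v where "v \<in> weighted_ball \<rho> \<inter> (\<Inter>i\<in>UNIV. C i)"
    by (meson ex_in_conv)
  then have v: "v \<in> weighted_ball \<rho>" and vC: "v \<in> C i" for i
    by auto
  show ?thesis
  proof (rule that[of v])
    show "summable (\<lambda>j. cmod (v j))" "(\<Sum>j. cmod (v j)) \<le> 1"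
      by (rule weighted_ball_summable[OF v \<rho>])+
    show "\<tau> j / 24 \<le> cmod (\<Sum>k. b j k * v k)" for j
      using vC[of j] by (simp add: C_def linear_form_def)
  qed
qed

section \<open>Norms on subspaces and norming functionals\<close>

locale normed_subspace =
  fixes V :: "'a::real_vector set" and N :: "'a \<Rightarrow> real"
  assumes subspace: "subspace V" and norm: "norm_on V N"
begin

lemma norm_nonneg: "x \<in> V \<Longrightarrow> 0 \<le> N x"
  and norm_eq_0: "x \<in> V \<Longrightarrow> N x = 0 \<longleftrightarrow> x = 0"
  and norm_scale: "x \<in> V \<Longrightarrow> N (c *\<^sub>R x) = \<bar>c\<bar> * N x"
  and norm_add: "x \<in> V \<Longrightarrow> y \<in> V \<Longrightarrow> N (x + y) \<le> N x + N y"
  using norm by (auto simp: norm_on_def)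

lemmas mem_add = subspace_add[OF subspace]
  and mem_diff = subspace_diff[OF subspace]
  and mem_scale = subspace_scale[OF subspace]
  and mem_zero = subspace_0[OF subspace]
  and mem_sum = subspace_sum[OF subspace]

lemma norm_minus: "x \<in> V \<Longrightarrow> N (- x) = N x"
  using norm_scale[of x "-1"] by simp

lemma norm_zero: "N 0 = 0"
  using norm_eq_0[OF mem_zero] by simp

lemma norm_commute: "x \<in> V \<Longrightarrow> y \<in> V \<Longrightarrow> N (x - y) = N (y - x)"
  using norm_minus[of "x - y"] mem_diff by simp

lemma norm_sum_le:
  assumes "finite A" "\<And>i. i \<in> A \<Longrightarrow> f i \<in> V"
  shows "N (\<Sum>i\<in>A. f i) \<le> (\<Sum>i\<in>A. N (f i))"
  using assms
proof (induction A rule: finite_induct)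
  case (insert i A)
  have "N (\<Sum>i\<in>insert i A. f i) \<le> N (f i) + N (\<Sum>i\<in>A. f i)"
    using insert by (auto intro!: norm_add mem_sum)
  with insert show ?case by auto
qed (simp add: norm_zero)

sublocale metric: Metric_space V "norm_dist V N"
proof
  fix x y z :: 'a
  show "0 \<le> norm_dist V N x y"
    by (auto simp: norm_dist_def norm_nonneg mem_diff)
  show "norm_dist V N x y = norm_dist V N y x"
    by (auto simp: norm_dist_def norm_commute)
  show "norm_dist V N x y = 0 \<longleftrightarrow> x = y" if "x \<in> V" "y \<in> V"
    using that by (simp add: norm_dist_def norm_eq_0 mem_diff)
  show "norm_dist V N x z \<le> norm_dist V N x y + norm_dist V N y z"
    if "x \<in> V" "y \<in> V" "z \<in> V"
    using that norm_add[of "x - y" "y - z"] by (simp add: norm_dist_def mem_diff)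
qed

lemma limitin_iff:
  "limitin (norm_topology V N) f l G \<longleftrightarrow>
     l \<in> V \<and> (\<forall>e>0. \<forall>\<^sub>F n in G. f n \<in> V \<and> N (f n - l) < e)"
  unfolding norm_topology_def metric.limitin_metric
  by (auto simp: norm_dist_def elim!: eventually_mono)

lemma limitin_add:
  assumes "limitin (norm_topology V N) f l G" "limitin (norm_topology V N) g m G"
  shows "limitin (norm_topology V N) (\<lambda>n. f n + g n) (l + m) G"
  unfolding limitin_iff
proof (intro conjI allI impI)
  show "l + m \<in> V"
    using assms mem_add by (auto simp: limitin_iff)
  fix e :: real assume "0 < e"
  then have "\<forall>\<^sub>F n in G. f n \<in> V \<and> N (f n - l) < e/2" "\<forall>\<^sub>F n in G. g n \<in> V \<and> N (g n - m) < e/2"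
    using assms half_gt_zero[of e] unfolding limitin_iff by blast+
  then show "\<forall>\<^sub>F n in G. f n + g n \<in> V \<and> N (f n + g n - (l + m)) < e"
  proof eventually_elim
    case (elim n)
    have "l \<in> V" "m \<in> V" using assms by (auto simp: limitin_iff)
    then have "N ((f n - l) + (g n - m)) < e"
      using elim norm_add[of "f n - l" "g n - m"] mem_diff by fastforce
    then show ?case using elim mem_add by (simp add: algebra_simps)
  qed
qed

lemma limitin_scale:
  assumes "limitin (norm_topology V N) f l G"
  shows "limitin (norm_topology V N) (\<lambda>n. c *\<^sub>R f n) (c *\<^sub>R l) G"
  unfolding limitin_iff
proof (intro conjI allI impI)
  show l: "c *\<^sub>R l \<in> V"
    using assms mem_scale by (auto simp: limitin_iff)
  fix e :: real assume e: "0 < e"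
  have "0 < e / (\<bar>c\<bar> + 1)" using e by simp
  then have "\<forall>\<^sub>F n in G. f n \<in> V \<and> N (f n - l) < e / (\<bar>c\<bar> + 1)"
    using assms unfolding limitin_iff by blast
  then show "\<forall>\<^sub>F n in G. c *\<^sub>R f n \<in> V \<and> N (c *\<^sub>R f n - c *\<^sub>R l) < e"
  proof eventually_elim
    case (elim n)
    have v: "f n - l \<in> V" using elim assms by (auto simp: limitin_iff mem_diff)
    have "N (c *\<^sub>R f n - c *\<^sub>R l) = \<bar>c\<bar> * N (f n - l)"
      using norm_scale[OF v, of c] by (simp add: scaleR_diff_right)
    also have "\<dots> \<le> (\<bar>c\<bar> + 1) * N (f n - l)"
      using norm_nonneg[OF v] by (intro mult_right_mono) auto
    also have "\<dots> < e"
      using elim by (simp add: field_simps)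
    finally show ?case using elim mem_scale by simp
  qed
qed

text \<open>
  The Hahn--Banach extension by one dimension.  The value \<open>c\<close> of the extension at \<open>z\<close> has to satisfy
  \<open>f w - N (w - z) \<le> c \<le> N (w + z) - f w\<close> for all \<open>w\<close> in \<open>W\<close>; the left sides lie below the right
  sides by the triangle inequality.  The extension is kept defined on the whole type by adding a
  multiple of a functional \<open>p\<close> that vanishes on \<open>W\<close>.
\<close>

lemma hahn_banach_step:
  assumes W: "subspace W" "W \<subseteq> V" and z: "z \<in> V" "z \<notin> W"
    and f: "linear f" "\<And>x. x \<in> W \<Longrightarrow> \<bar>f x\<bar> \<le> N x"
  shows "\<exists>g :: 'a \<Rightarrow> real. linear g \<and> (\<forall>x\<in>W. g x = f x) \<and> (\<forall>x\<in>W. \<forall>t. \<bar>g (x + t *\<^sub>R z)\<bar> \<le> N (x + t *\<^sub>R z))"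
proof -
  interpret f: linear f by fact
  define c where "c = (SUP w\<in>W. f w - N (w - z))"
  have key: "f w1 - N (w1 - z) \<le> N (w2 + z) - f w2" if "w1 \<in> W" "w2 \<in> W" for w1 w2
  proof -
    have "f w1 + f w2 \<le> N (w1 + w2)"
      using f(2)[of "w1 + w2"] that W(1) by (simp add: f.add subspace_add)
    also have "w1 + w2 = (w1 - z) + (w2 + z)" by simp
    also have "N \<dots> \<le> N (w1 - z) + N (w2 + z)"
      using that W(2) z by (intro norm_add mem_diff mem_add) auto
    finally show ?thesis by simp
  qed
  have ne: "W \<noteq> {}" using subspace_0[OF W(1)] by auto
  have upper: "c \<le> N (w + z) - f w" if "w \<in> W" for w
    unfolding c_def using ne key that by (intro cSUP_least) auto
  have lower: "f w - N (w - z) \<le> c" if "w \<in> W" for w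
    unfolding c_def using that key[OF _ subspace_0[OF W(1)]] 
    by (intro cSUP_upper bdd_aboveI2) auto
  obtain B where B: "B \<subseteq> W" "independent B" "W \<subseteq> span B"
    using maximal_independent_subset[of W] by blast
  have spanB: "span B = W"
    using B W(1) by (simp add: span_minimal subset_antisym)
  have "independent (insert z B)"
    using B(2) z(2) spanB by (simp add: independent_insertI)
  then obtain p :: "'a \<Rightarrow> real" where p: "linear p" "\<forall>x\<in>insert z B. p x = (if x = z then 1 else 0)"
    using linear_independent_extend[of "insert z B" "\<lambda>x. if x = z then 1 else 0"] by blast
  interpret p: linear p by fact
  have pz: "p z = 1" using p(2) by simp
  have "p x = 0" if "x \<in> B" for x
    using p(2) that B(1) z(2) by auto
  then have pW: "p x = 0" if "x \<in> W" for x
    using linear_eq_0_on_span[OF p(1), of B x] that spanB by blast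
  define g where "g x = f x + (c - f z) * p x" for x
  have g: "linear g"
    by (rule linearI) (auto simp: g_def f.add p.add f.scale p.scale algebra_simps)
  have gval: "g (x + t *\<^sub>R z) = f x + t * c" if "x \<in> W" for x t
    using that by (simp add: g_def f.add p.add f.scale p.scale pz pW algebra_simps)
  have le: "f x + t * c \<le> N (x + t *\<^sub>R z)" if x: "x \<in> W" for x t
  proof -
    consider "t = 0" | "0 < t" | "t < 0" by linarith
    then show ?thesis
    proof cases
      case 1
      then show ?thesis using f(2)[OF x] by simp
    next
      case 2
      have w: "x /\<^sub>R t \<in> W" using W(1) x by (rule subspace_scale)
      have "f x + t * c = t * (f (x /\<^sub>R t) + c)"
        using 2 by (simp add: f.scale field_simps)
      also have "\<dots> \<le> t * N (x /\<^sub>R t + z)"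
        using upper[OF w] 2 by (intro mult_left_mono) auto
      also have "\<dots> = N (t *\<^sub>R (x /\<^sub>R t + z))"
        using w W(2) z 2 by (subst norm_scale) (auto intro: mem_add)
      finally show ?thesis using 2 by (simp add: scaleR_add_right)
    next
      case 3
      define s where "s = - t"
      have s: "0 < s" "t = - s" using 3 by (auto simp: s_def)
      have w: "x /\<^sub>R s \<in> W" using W(1) x by (rule subspace_scale)
      have "f x + t * c = s * (f (x /\<^sub>R s) - c)"
        using s by (simp add: f.scale field_simps)
      also have "\<dots> \<le> s * N (x /\<^sub>R s - z)"
        using lower[OF w] s by (intro mult_left_mono) auto
      also have "\<dots> = N (s *\<^sub>R (x /\<^sub>R s - z))"
        using w W(2) z s by (subst norm_scale) (auto intro: mem_diff)
      finally show ?thesis using s by (simp add: scaleR_diff_right)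
    qed
  qed
  have "\<bar>g (x + t *\<^sub>R z)\<bar> \<le> N (x + t *\<^sub>R z)" if x: "x \<in> W" for x t
  proof -
    have "x + t *\<^sub>R z \<in> V" using x W z by (auto intro: mem_add mem_scale)
    then have "N (- x + (- t) *\<^sub>R z) = N (x + t *\<^sub>R z)"
      using norm_minus[of "x + t *\<^sub>R z"] by simp
    moreover have "f (- x) + (- t) * c \<le> N (- x + (- t) *\<^sub>R z)"
      using x W(1) by (intro le) (simp add: subspace_neg)
    ultimately show ?thesis
      using le[OF x, of t] gval[OF x, of t] by (simp add: f.neg)
  qed
  moreover have "g x = f x" if "x \<in> W" for x
    using that by (simp add: g_def pW)
  ultimately show ?thesis using g by blast
qed

text \<open>
  Finitely many extension steps suffice here, since the functionals are only evaluated on the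
  finite-dimensional ranges of the partial sums operators.
\<close>

lemma exists_norming_functional:
  assumes "finite B" "B \<subseteq> V" "y \<in> V"
  shows "\<exists>f :: 'a \<Rightarrow> real. linear f \<and> f y = N y \<and> (\<forall>x\<in>span (insert y B). \<bar>f x\<bar> \<le> N x)"
  using assms(1,2)
proof (induction B rule: finite_induct)
  case empty
  show ?case
  proof (cases "y = 0")
    case True
    then show ?thesis
      by (intro exI[of _ "\<lambda>_. 0"]) (auto simp: norm_zero module_hom_zero)
  next
    case False
    then have "independent {y}" by simp
    then obtain f :: "'a \<Rightarrow> real" where f: "linear f" "\<forall>x\<in>{y}. f x = N y"
      using linear_independent_extend[of "{y}" "\<lambda>_. N y"] by blast
    have "\<bar>f x\<bar> \<le> N x" if x: "x \<in> span {y}" for x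
    proof -
      obtain k where k: "x = k *\<^sub>R y" using x by (auto simp: span_singleton)
      then show ?thesis
        using f assms(3) norm_nonneg[OF assms(3)] by (simp add: k linear_scale norm_scale abs_mult)
    qed
    with f show ?thesis by auto
  qed
next
  case (insert z B)
  then obtain f :: "'a \<Rightarrow> real" where f: "linear f" "f y = N y"
    "\<And>x. x \<in> span (insert y B) \<Longrightarrow> \<bar>f x\<bar> \<le> N x"
    by auto
  have eq: "insert y (insert z B) = insert z (insert y B)" by auto
  show ?case
  proof (cases "z \<in> span (insert y B)")
    case True
    then have "span (insert y (insert z B)) = span (insert y B)"
      unfolding eq by (rule span_redundant)
    with f show ?thesis by auto
  next
    case False
    have sub: "span (insert y B) \<subseteq> V"
      using insert.prems assms(3) by (intro span_minimal subspace) auto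
    obtain g :: "'a \<Rightarrow> real" where g: "linear g" "\<forall>x\<in>span (insert y B). g x = f x"
      "\<And>x t. x \<in> span (insert y B) \<Longrightarrow> \<bar>g (x + t *\<^sub>R z)\<bar> \<le> N (x + t *\<^sub>R z)"
      using hahn_banach_step[OF subspace_span sub _ False f(1,3)] insert.prems by auto
    have "\<bar>g x\<bar> \<le> N x" if x: "x \<in> span (insert z (insert y B))" for x
    proof -
      obtain t where "x - t *\<^sub>R z \<in> span (insert y B)"
        using x span_breakdown_eq[of x z "insert y B"] by blast
      from g(3)[OF this, of t] show ?thesis by simp
    qed
    moreover have "g y = N y"
      using g(2) f(2) by (simp add: span_base)
    ultimately show ?thesis using g(1) unfolding eq by blast
  qed
qed

lemma convergent_absolute_series:
  assumes complete: "Metric_space.mcomplete V (norm_dist V N)"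
    and x: "\<And>j. x j \<in> V" "\<And>j. N (x j) \<le> 1" and c: "summable (\<lambda>j. \<bar>c j\<bar>)"
  obtains s where "s \<in> V" and "N s \<le> (\<Sum>j. \<bar>c j\<bar>)"
    and "(\<lambda>n. N ((\<Sum>j<n. c j *\<^sub>R x j) - s)) \<longlonglongrightarrow> 0"
proof -
  define p where "p n = (\<Sum>j<n. c j *\<^sub>R x j)" for n
  have pV: "p n \<in> V" for n
    unfolding p_def by (intro mem_sum mem_scale x)
  have diff: "N (p n - p m) \<le> (\<Sum>j=m..<n. \<bar>c j\<bar>)" if "m \<le> n" for m n
  proof -
    have "p n - p m = (\<Sum>j=m..<n. c j *\<^sub>R x j)"
      using sum_diff_nat_ivl[of 0 m n "\<lambda>j. c j *\<^sub>R x j"] that by (simp add: p_def lessThan_atLeast0)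
    also have "N \<dots> \<le> (\<Sum>j=m..<n. N (c j *\<^sub>R x j))"
      by (intro norm_sum_le mem_scale x) auto
    also have "\<dots> \<le> (\<Sum>j=m..<n. \<bar>c j\<bar>)"
      using x by (intro sum_mono) (simp add: norm_scale mult_left_le)
    finally show ?thesis .
  qed
  have "metric.MCauchy p"
    unfolding metric.MCauchy_def
  proof (intro conjI allI impI)
    show "range p \<subseteq> V" using pV by auto
    fix e :: real assume "0 < e"
    then obtain M where M: "\<And>m n. M \<le> m \<Longrightarrow> norm (\<Sum>j=m..<n. \<bar>c j\<bar>) < e"
      using c unfolding summable_Cauchy by blast
    have small: "N (p n - p m) < e" if "M \<le> m" "m \<le> n" for m n
      using diff[OF that(2)] M[OF that(1), of n] by (smt (verit) real_norm_def)
    show "\<exists>M. \<forall>n n'. M \<le> n \<longrightarrow> M \<le> n' \<longrightarrow> norm_dist V N (p n) (p n') < e"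
    proof (intro exI[of _ M] allI impI)
      fix n n' assume "M \<le> n" "M \<le> n'"
      then show "norm_dist V N (p n) (p n') < e"
        using small[of n n'] small[of n' n] norm_commute[OF pV pV, of n n'] pV
        by (cases "n \<le> n'") (auto simp: norm_dist_def)
    qed
  qed
  then obtain s where "limitin metric.mtopology p s sequentially"
    using complete by (auto simp: metric.mcomplete_def)
  then have "limitin (norm_topology V N) p s sequentially"
    by (simp add: norm_topology_def)
  then have s: "s \<in> V" and ev: "\<And>e. 0 < e \<Longrightarrow> \<forall>\<^sub>F n in sequentially. N (p n - s) < e"
    by (auto simp: limitin_iff elim: eventually_mono)
  have lim: "(\<lambda>n. N (p n - s)) \<longlonglongrightarrow> 0"
    unfolding tendsto_iff using ev norm_nonneg[OF mem_diff[OF pV s]] by simp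
  have "N s \<le> (\<Sum>j. \<bar>c j\<bar>) + N (p n - s)" for n
  proof -
    have "N s \<le> N (p n) + N (s - p n)"
      using norm_add[of "p n" "s - p n"] pV s mem_diff by simp
    moreover have "N (p n) \<le> (\<Sum>j<n. \<bar>c j\<bar>)"
      using diff[of 0 n] by (simp add: p_def lessThan_atLeast0)
    moreover have "(\<Sum>j<n. \<bar>c j\<bar>) \<le> (\<Sum>j. \<bar>c j\<bar>)"
      by (rule sum_le_suminf[OF c]) auto
    ultimately show ?thesis using norm_commute[OF pV s, of n] by simp
  qed
  then have "N s \<le> (\<Sum>j. \<bar>c j\<bar>) + 0"
    by (intro LIMSEQ_le_const[OF tendsto_add[OF tendsto_const lim]]) auto
  with s lim that show ?thesis by (simp add: p_def)
qed

lemma bounded_functional_series: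
  assumes x: "\<And>j. x j \<in> V" and s: "s \<in> V"
    and lim: "(\<lambda>n. N ((\<Sum>j<n. c j *\<^sub>R x j) - s)) \<longlonglongrightarrow> 0"
    and add: "\<And>x y. x \<in> V \<Longrightarrow> y \<in> V \<Longrightarrow> \<phi> (x + y) = \<phi> x + \<phi> y"
    and scale: "\<And>c x. x \<in> V \<Longrightarrow> \<phi> (c *\<^sub>R x) = c * \<phi> x"
    and le: "\<And>x. x \<in> V \<Longrightarrow> \<bar>\<phi> x\<bar> \<le> A * N x"
  shows "(\<lambda>j. c j * \<phi> (x j)) sums \<phi> s"
proof -
  define p where "p n = (\<Sum>j<n. c j *\<^sub>R x j)" for n
  have pV: "p n \<in> V" for n
    unfolding p_def by (intro mem_sum mem_scale x)
  have \<phi>p: "\<phi> (p n) = (\<Sum>j<n. c j * \<phi> (x j))" for n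
  proof (induction n)
    case 0
    show ?case using scale[OF mem_zero, of 0] by (simp add: p_def)
  next
    case (Suc n)
    have "\<phi> (p (Suc n)) = \<phi> (p n + c n *\<^sub>R x n)"
      by (simp add: p_def)
    then show ?case using Suc add[OF pV mem_scale[OF x]] scale[OF x] by simp
  qed
  have bound: "norm (\<phi> (p n) - \<phi> s) \<le> A * N (p n - s)" for n
  proof -
    have "\<phi> (p n) = \<phi> (p n - s) + \<phi> s"
      using add[OF mem_diff[OF pV s] s] by simp
    then show ?thesis using le[OF mem_diff[OF pV s]] by simp
  qed
  have "(\<lambda>n. A * N (p n - s)) \<longlonglongrightarrow> 0"
    using tendsto_mult_right_zero[OF lim] by (simp add: p_def)
  then have "(\<lambda>n. \<phi> (p n) - \<phi> s) \<longlonglongrightarrow> 0"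
    by (rule Lim_null_comparison[OF always_eventually, rotated]) (use bound in blast)
  then have "(\<lambda>n. \<phi> (p n)) \<longlonglongrightarrow> \<phi> s"
    by (rule LIM_zero_cancel)
  then show ?thesis by (simp add: sums_def \<phi>p)
qed

end

section \<open>Partial sums operators of a filter basis\<close>

locale continuous_f_basis = normed_subspace V N
  for V :: "'a::real_vector set" and N :: "'a \<Rightarrow> real" +
  fixes F :: "nat filter" and u :: "nat \<Rightarrow> 'a"
  assumes basis: "f_basis F V N u"
    and cont: "\<And>k. continuous_map (norm_topology V N) euclideanreal (coord F V N u k)"
begin

abbreviation cf :: "nat \<Rightarrow> 'a \<Rightarrow> real" where
  "cf \<equiv> coord F V N u"

abbreviation S :: "nat \<Rightarrow> 'a \<Rightarrow> 'a" where
  "S \<equiv> partial_sum_op F V N u"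

lemma basis_mem: "u k \<in> V"
  using basis by (simp add: f_basis_def)

lemma expansion_unique: "x \<in> V \<Longrightarrow> f_expansion F V N u x c \<Longrightarrow> (\<lambda>k. cf k x) = c"
  using basis unfolding f_basis_def coord_def by (metis the1_equality)

lemma expansion: "x \<in> V \<Longrightarrow> f_expansion F V N u x (\<lambda>k. cf k x)"
  using basis unfolding f_basis_def coord_def by (metis theI')

lemma coord_add: assumes "x \<in> V" "y \<in> V" shows "cf k (x + y) = cf k x + cf k y"
proof -
  have "f_expansion F V N u (x + y) (\<lambda>k. cf k x + cf k y)"
    using limitin_add[OF expansion[OF assms(1), unfolded f_expansion_def]
        expansion[OF assms(2), unfolded f_expansion_def]]
    by (simp add: f_expansion_def scaleR_add_left sum.distrib)
  from expansion_unique[OF mem_add[OF assms] this] show ?thesis by meson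
qed

lemma coord_scale: assumes "x \<in> V" shows "cf k (c *\<^sub>R x) = c * cf k x"
proof -
  have "f_expansion F V N u (c *\<^sub>R x) (\<lambda>k. c * cf k x)"
    using limitin_scale[OF expansion[OF assms, unfolded f_expansion_def], of c]
    by (simp add: f_expansion_def scaleR_sum_right)
  from expansion_unique[OF mem_scale[OF assms] this] show ?thesis by meson
qed

text \<open>
  A linear functional continuous at the origin is bounded: with \<open>\<delta>\<close> belonging to the tolerance
  \<open>1\<close>, every vector can be rescaled to norm \<open>\<delta> / 2\<close>.
\<close>

lemma coord_bounded: "\<exists>B\<ge>0. \<forall>x\<in>V. \<bar>cf k x\<bar> \<le> B * N x"
proof -
  have "limitin euclideanreal (cf k) (cf k 0) (atin metric.mtopology 0)"
    using cont[of k] mem_zero by (simp add: continuous_map_atin norm_topology_def)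
  moreover have "cf k 0 = 0"
    using coord_scale[OF mem_zero, of k 0] by simp
  ultimately have "\<forall>e>0. \<exists>\<delta>>0. \<forall>x. x \<in> V \<and> 0 < norm_dist V N x 0 \<and> norm_dist V N x 0 < \<delta> \<longrightarrow> \<bar>cf k x\<bar> < e"
    by (simp add: tendsto_iff metric.eventually_atin_metric mem_zero)
  then obtain \<delta> where \<delta>: "0 < \<delta>"
    and small: "\<And>x. x \<in> V \<Longrightarrow> 0 < N x \<Longrightarrow> N x < \<delta> \<Longrightarrow> \<bar>cf k x\<bar> < 1"
    using mem_zero by (auto simp: norm_dist_def dest!: spec[of _ "1::real"])
  have "\<bar>cf k x\<bar> \<le> 2 / \<delta> * N x" if x: "x \<in> V" for x
  proof (cases "x = 0")
    case True
    then show ?thesis using \<open>cf k 0 = 0\<close> by (simp add: norm_zero)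
  next
    case False
    then have Nx: "0 < N x" using x norm_nonneg[OF x] norm_eq_0[OF x] by simp
    define c where "c = \<delta> / (2 * N x)"
    have c: "0 < c" using \<delta> Nx by (simp add: c_def)
    have "N (c *\<^sub>R x) = \<delta> / 2" using x Nx abs_of_pos[OF c] by (simp add: norm_scale c_def)
    then have "\<bar>cf k (c *\<^sub>R x)\<bar> < 1" using \<delta> x by (intro small mem_scale) auto
    then have "c * \<bar>cf k x\<bar> < 1" using c x by (simp add: coord_scale abs_mult)
    then show ?thesis
      using Nx \<delta> by (simp add: c_def field_simps)
  qed
  then show ?thesis using \<delta> by (intro exI[of _ "2 / \<delta>"]) auto
qed

lemma partial_sum_mem: "S n x \<in> V"
  unfolding partial_sum_op_def by (intro mem_sum mem_scale basis_mem)

lemma partial_sum_span: "S n x \<in> span (u ` {..n})"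
  unfolding partial_sum_op_def by (intro span_sum span_scale span_base) auto

lemma partial_sum_add: "x \<in> V \<Longrightarrow> y \<in> V \<Longrightarrow> S n (x + y) = S n x + S n y"
  by (simp add: partial_sum_op_def coord_add scaleR_add_left sum.distrib)

lemma partial_sum_scale: "x \<in> V \<Longrightarrow> S n (c *\<^sub>R x) = c *\<^sub>R S n x"
  by (simp add: partial_sum_op_def coord_scale scaleR_sum_right)

lemma partial_sum_limit:
  assumes "x \<in> V" "0 < e"
  shows "\<forall>\<^sub>F n in F. N (S n x - x) < e"
  using expansion[OF assms(1)] assms(2)
  by (auto simp: f_expansion_def limitin_iff partial_sum_op_def elim: eventually_mono)

text \<open>
  Without this the supremum that defines the operator norm would be an unspecified real number.
\<close>

lemma partial_sum_bdd_above: "bdd_above ((\<lambda>x. N (S n x)) ` {x \<in> V. N x \<le> 1})"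
proof -
  obtain B where B: "\<And>k. 0 \<le> B k" "\<And>k x. x \<in> V \<Longrightarrow> \<bar>cf k x\<bar> \<le> B k * N x"
    using coord_bounded by metis
  show ?thesis
  proof (rule bdd_aboveI2)
    fix x assume x: "x \<in> {x \<in> V. N x \<le> 1}"
    have "N (S n x) \<le> (\<Sum>k\<le>n. N (cf k x *\<^sub>R u k))"
      unfolding partial_sum_op_def by (intro norm_sum_le mem_scale basis_mem) auto
    also have "\<dots> \<le> (\<Sum>k\<le>n. B k * N (u k))"
    proof (rule sum_mono)
      fix k
      have "\<bar>cf k x\<bar> \<le> B k * 1"
        using B(2)[of x k] mult_left_mono[OF _ B(1)[of k], of "N x" 1] x by auto
      then show "N (cf k x *\<^sub>R u k) \<le> B k * N (u k)"
        using norm_nonneg[OF basis_mem[of k]] by (simp add: norm_scale basis_mem mult_right_mono)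
    qed
    finally show "N (S n x) \<le> (\<Sum>k\<le>n. B k * N (u k))" .
  qed
qed

lemma norm_partial_sum_le:
  assumes x: "x \<in> V"
  shows "N (S n x) \<le> operator_norm V N (S n) * N x"
proof (cases "x = 0")
  case True
  then show ?thesis
    using partial_sum_scale[OF mem_zero, of n 0] by (simp add: norm_zero)
next
  case False
  then have Nx: "0 < N x" using x norm_nonneg[OF x] norm_eq_0[OF x] by simp
  have "N (S n (x /\<^sub>R N x)) \<le> operator_norm V N (S n)"
    unfolding operator_norm_def
    using x Nx by (intro cSUP_upper partial_sum_bdd_above) (auto simp: norm_scale mem_scale)
  then show ?thesis
    using Nx x by (simp add: partial_sum_scale norm_scale partial_sum_mem field_simps)
qed

lemma exists_almost_norming:
  assumes "\<eta> < operator_norm V N (S n)"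
  shows "\<exists>x\<in>V. N x \<le> 1 \<and> \<eta> \<le> N (S n x)"
proof -
  have "0 \<in> {x \<in> V. N x \<le> 1}" by (simp add: mem_zero norm_zero)
  then obtain x where "x \<in> {x \<in> V. N x \<le> 1}" "\<eta> < N (S n x)"
    using assms less_cSUP_iff[OF _ partial_sum_bdd_above[of n]] unfolding operator_norm_def by blast
  then show ?thesis by auto
qed

end

lemma summable_inverse_of_infsum_finite:
  fixes a :: "nat \<Rightarrow> real"
  assumes "\<And>n. 0 < a n" and fin: "(\<Sum>\<^sub>\<infinity>n\<in>I. ennreal (inverse (a n))) \<noteq> \<infinity>"
  shows "summable (\<lambda>n. if n \<in> I then inverse (a n) else 0)"
proof (rule summableI_nonneg_bounded)
  let ?T = "\<Sum>\<^sub>\<infinity>n\<in>I. ennreal (inverse (a n))"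
  show "0 \<le> (if n \<in> I then inverse (a n) else 0)" for n
    using assms(1)[of n] by simp
  show "(\<Sum>i<n. if i \<in> I then inverse (a i) else 0) \<le> enn2real ?T" for n
  proof -
    have "(\<Sum>i<n. if i \<in> I then inverse (a i) else 0) = (\<Sum>i\<in>{..<n} \<inter> I. inverse (a i))"
      by (simp add: sum.inter_restrict)
    also have "ennreal \<dots> = (\<Sum>i\<in>{..<n} \<inter> I. ennreal (inverse (a i)))"
      using assms(1) by (intro sum_ennreal[symmetric]) (simp add: less_imp_le)
    also have "\<dots> \<le> ?T"
      by (subst nonneg_infsum_complete) (auto intro!: SUP_upper)
    also have "\<dots> = ennreal (enn2real ?T)"
      using fin by (simp add: top.not_eq_extremum)
    finally show ?thesis
      by (simp add: ennreal_le_iff)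
  qed
qed

text \<open>
  Suppose that \<open>1 / a n\<close> is summable over a stationary set \<open>I\<close>.  Choose \<open>X n\<close> in the unit ball with
  \<open>N (S n (X n)) \<ge> a n / 2\<close> and a functional \<open>f n\<close> norming \<open>S n (X n)\<close>; then \<open>\<phi> n = f n \<circ> S n\<close>
  has norm at most \<open>a n\<close>.  The plank theorem for the matrix \<open>\<phi> i (X j) / a i\<close> yields complex
  coefficients \<open>v j\<close>.  Their real and imaginary parts are the coefficients of two vectors \<open>x\<close> and
  \<open>y\<close> in the unit ball with \<open>|\<phi> n x| + |\<phi> n y| > 4\<close> for all large \<open>n\<close> in \<open>I\<close>.  But the sets on
  which \<open>S n x\<close> and \<open>S n y\<close> are within distance 1 of \<open>x\<close> and \<open>y\<close> belong to the filter, so they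
  meet \<open>I\<close> in a common large index, and there both values are less than 2.  It does no harm that
  neither vector alone has large partial sums along all of \<open>I\<close>.
\<close>

lemma (in continuous_f_basis) admissible_of_norms:
  assumes complete: "Metric_space.mcomplete V (norm_dist V N)"
    and free: "free_filter F" and a: "\<And>n. 0 < a n"
    and norms: "\<And>n. operator_norm V N (S n) = a n"
  shows "admissible1 F a"
  unfolding admissible1_def
proof (intro allI impI, rule ccontr)
  fix I
  assume stat: "stationary F I" and fin: "(\<Sum>\<^sub>\<infinity>n\<in>I. ennreal (inverse (a n))) \<noteq> \<infinity>"
  define t where "t n = (if n \<in> I then inverse (a n) else 0)" for n
  have t: "summable t" unfolding t_def by (rule summable_inverse_of_infsum_finite[OF a fin])
  have t0: "0 \<le> t n" for n using a[of n] by (simp add: t_def)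
  obtain m where m: "norm (\<Sum>i. t (i + m)) < 1/200"
    using suminf_exist_split[OF _ t, of "1/200"] by auto
  \<comment> \<open>Beyond \<open>m\<close> the widths are \<open>100 / a n\<close> on \<open>I\<close>, where \<open>100 / 24 > 4\<close> gives the contradiction;
      the geometric term makes all widths positive.  Each part has sum at most \<open>1/2\<close>.\<close>
  define \<tau> where "\<tau> n = (if m \<le> n then 100 * t n else 0) + (1/2)^n * (1/4)" for n
  have "(\<lambda>n. if m \<le> n then 100 * t n else 0) sums (100 * (\<Sum>i. t (i + m)))"
  proof -
    have "(\<lambda>i. 100 * t (i + m)) sums (100 * (\<Sum>i. t (i + m)))"
      using t by (intro sums_mult summable_sums summable_ignore_initial_segment)
    then show ?thesis
      by (subst sums_iff_shift'[of _ m, symmetric]) (auto simp: sums_iff_shift)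
  qed
  moreover have "(\<lambda>n. (1/2)^n * (1/4)) sums (2 * (1/4) :: real)"
    using geometric_sums[of "1/2 :: real"] by (intro sums_mult2) simp
  ultimately have \<tau>sums: "\<tau> sums (100 * (\<Sum>i. t (i + m)) + 2 * (1/4))"
    unfolding \<tau>_def by (rule sums_add)
  have \<tau>_pos: "0 < \<tau> n" for n
    unfolding \<tau>_def using t0[of n] by (intro add_nonneg_pos) auto
  have \<tau>_le: "suminf \<tau> \<le> 1"
    using \<tau>sums m by (simp add: sums_iff)
  have "\<exists>x\<in>V. N x \<le> 1 \<and> a n / 2 \<le> N (S n x)" for n
    using a[of n] norms[of n] by (intro exists_almost_norming) simp
  then obtain X where X: "\<And>n. X n \<in> V" "\<And>n. N (X n) \<le> 1" "\<And>n. a n / 2 \<le> N (S n (X n))"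
    by metis
  have "\<exists>f :: 'a \<Rightarrow> real. linear f \<and> f (S n (X n)) = N (S n (X n)) \<and> (\<forall>x\<in>span (u ` {..n}). \<bar>f x\<bar> \<le> N x)" for n
    using exists_norming_functional[of "u ` {..n}" "S n (X n)"] basis_mem partial_sum_mem
      span_redundant[OF partial_sum_span[of n "X n"]] by auto
  then obtain f where f: "\<And>n. linear (f n :: 'a \<Rightarrow> real)" "\<And>n. f n (S n (X n)) = N (S n (X n))"
    "\<And>n x. x \<in> span (u ` {..n}) \<Longrightarrow> \<bar>f n x\<bar> \<le> N x"
    by metis
  define \<phi> where "\<phi> n x = f n (S n x)" for n x
  have \<phi>_le_S: "\<bar>\<phi> n x\<bar> \<le> N (S n x)" for n x
    unfolding \<phi>_def by (intro f partial_sum_span)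
  have \<phi>_le: "\<bar>\<phi> n x\<bar> \<le> a n * N x" if "x \<in> V" for n x
    using \<phi>_le_S[of n x] norm_partial_sum_le[OF that, of n] norms[of n] by simp
  have \<phi>_add: "\<phi> n (x + y) = \<phi> n x + \<phi> n y" if "x \<in> V" "y \<in> V" for n x y
    using that f(1)[of n] by (simp add: \<phi>_def partial_sum_add linear_add)
  have \<phi>_scale: "\<phi> n (c *\<^sub>R x) = c * \<phi> n x" if "x \<in> V" for n x c
    using that f(1)[of n] by (simp add: \<phi>_def partial_sum_scale linear_scale)
  define b :: "nat \<Rightarrow> nat \<Rightarrow> complex" where "b i j = of_real (\<phi> i (X j) / a i)" for i j
  have b: "cmod (b i j) \<le> 1" for i j
  proof -
    have "\<bar>\<phi> i (X j)\<bar> \<le> a i * 1"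
      using order_trans[OF \<phi>_le[OF X(1)[of j], of i] mult_left_mono[OF X(2)[of j], of "a i"]] a[of i]
      by simp
    then show ?thesis using a[of i] by (simp add: b_def norm_divide)
  qed
  have diag: "1/2 \<le> cmod (b i i)" for i
    using X(3)[of i] f(2)[of i] a[of i] norm_nonneg[OF partial_sum_mem, of i "X i"]
    by (simp add: b_def \<phi>_def norm_divide field_simps)
  obtain v where v: "summable (\<lambda>j. cmod (v j))" "(\<Sum>j. cmod (v j)) \<le> 1"
    and big: "\<And>j. \<tau> j / 24 \<le> cmod (\<Sum>k. b j k * v k)"
    using complex_plank[where b = b and \<tau> = \<tau>, OF b diag \<tau>_pos sums_summable[OF \<tau>sums] \<tau>_le] by blast
  have part: "\<exists>s\<in>V. N s \<le> 1 \<and> (\<forall>i. (\<lambda>j. c j * \<phi> i (X j)) sums \<phi> i s)"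
    if c: "\<And>j. \<bar>c j\<bar> \<le> cmod (v j)" for c
  proof -
    have sc: "summable (\<lambda>j. \<bar>c j\<bar>)"
      by (rule summable_comparison_test'[OF v(1)]) (use c in auto)
    obtain s where s: "s \<in> V" "N s \<le> (\<Sum>j. \<bar>c j\<bar>)"
      "(\<lambda>n. N ((\<Sum>j<n. c j *\<^sub>R X j) - s)) \<longlonglongrightarrow> 0"
      by (rule convergent_absolute_series[OF complete X(1,2) sc])
    have "N s \<le> 1"
      using s(2) suminf_le[OF c sc v(1)] v(2) by simp
    moreover have "(\<lambda>j. c j * \<phi> i (X j)) sums \<phi> i s" for i
      using bounded_functional_series[OF X(1) s(1,3) \<phi>_add \<phi>_scale \<phi>_le] .
    ultimately show ?thesis using s(1) by blast
  qed
  obtain x where x: "x \<in> V" "N x \<le> 1" "\<And>i. (\<lambda>j. Re (v j) * \<phi> i (X j)) sums \<phi> i x"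
    using part[of "\<lambda>j. Re (v j)"] abs_Re_le_cmod by blast
  obtain y where y: "y \<in> V" "N y \<le> 1" "\<And>i. (\<lambda>j. Im (v j) * \<phi> i (X j)) sums \<phi> i y"
    using part[of "\<lambda>j. Im (v j)"] abs_Im_le_cmod by blast
  have form: "(\<Sum>k. b i k * v k) = Complex (\<phi> i x / a i) (\<phi> i y / a i)" for i
  proof -
    have "(\<lambda>k. Complex (Re (v k) * \<phi> i (X k) / a i) (Im (v k) * \<phi> i (X k) / a i))
        sums Complex (\<phi> i x / a i) (\<phi> i y / a i)"
      unfolding sums_complex_iff using sums_divide[OF x(3)] sums_divide[OF y(3)] by simp
    moreover have "Complex (Re (v k) * \<phi> i (X k) / a i) (Im (v k) * \<phi> i (X k) / a i) = b i k * v k" for k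
      by (auto simp: b_def complex_eq_iff)
    ultimately show ?thesis by (simp add: sums_iff)
  qed
  have "\<forall>\<^sub>F n in F. n \<in> {n. N (S n x - x) < 1 \<and> N (S n y - y) < 1 \<and> m \<le> n}"
  proof -
    have "finite (- {m..})"
      by (rule finite_subset[of _ "{..<m}"]) auto
    then have "\<forall>\<^sub>F n in F. n \<in> {m..}"
      using free unfolding free_filter_def by blast
    moreover have "\<forall>\<^sub>F n in F. N (S n x - x) < 1" "\<forall>\<^sub>F n in F. N (S n y - y) < 1"
      by (intro partial_sum_limit x y zero_less_one)+
    ultimately show ?thesis
      by eventually_elim simp
  qed
  then obtain n where n: "n \<in> I" "N (S n x - x) < 1" "N (S n y - y) < 1" "m \<le> n"
    using stat unfolding stationary_def by blast
  have less2: "\<bar>\<phi> n z\<bar> < 2" if "z \<in> V" "N z \<le> 1" "N (S n z - z) < 1" for z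
  proof -
    have "N (S n z) \<le> N (S n z - z) + N z"
      using norm_add[OF mem_diff[OF partial_sum_mem[of n z] that(1)] that(1)] by simp
    then show ?thesis using \<phi>_le_S[of n z] that by simp
  qed
  have "100 * inverse (a n) / 24 \<le> \<tau> n / 24"
    using n by (simp add: \<tau>_def t_def)
  also have "\<dots> \<le> \<bar>\<phi> n x / a n\<bar> + \<bar>\<phi> n y / a n\<bar>"
    using order_trans[OF big[of n, unfolded form] cmod_le] by simp
  also have "\<dots> = (\<bar>\<phi> n x\<bar> + \<bar>\<phi> n y\<bar>) * inverse (a n)"
    using a[of n] by (simp add: field_simps)
  also have "\<dots> < 4 * inverse (a n)"
    using less2[OF x(1,2) n(2)] less2[OF y(1,2) n(3)] a[of n] by (intro mult_strict_right_mono) auto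
  finally show False using a[of n] by simp
qed

section \<open>The Banach space of absolutely summable sequences\<close>

lemma (in normed_subspace) continuous_map_lipschitz:
  assumes "\<And>x y. x \<in> V \<Longrightarrow> y \<in> V \<Longrightarrow> \<bar>\<phi> x - \<phi> y\<bar> \<le> B * N (x - y)"
  shows "continuous_map (norm_topology V N) euclideanreal \<phi>"
  unfolding norm_topology_def metric.continuous_map_from_metric
proof (intro conjI ballI allI impI)
  fix x U assume x: "x \<in> V" and "openin euclideanreal U \<and> \<phi> x \<in> U"
  then obtain e where e: "0 < e" "ball (\<phi> x) e \<subseteq> U"
    by (auto simp: open_contains_ball)
  show "\<exists>r>0. \<forall>y. y \<in> V \<and> norm_dist V N x y < r \<longrightarrow> \<phi> y \<in> U"
  proof (intro exI[of _ "e / (\<bar>B\<bar> + 1)"] conjI allI impI)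
    show "0 < e / (\<bar>B\<bar> + 1)" using e by simp
    fix y assume y: "y \<in> V \<and> norm_dist V N x y < e / (\<bar>B\<bar> + 1)"
    then have less: "N (x - y) * (\<bar>B\<bar> + 1) < e"
      using x by (auto simp: norm_dist_def field_simps)
    have "\<bar>\<phi> x - \<phi> y\<bar> \<le> B * N (x - y)"
      using assms x y by blast
    also have "\<dots> \<le> (\<bar>B\<bar> + 1) * N (x - y)"
      using x y by (intro mult_right_mono norm_nonneg mem_diff) auto
    finally have "\<phi> y \<in> ball (\<phi> x) e"
      using less by (simp add: dist_real_def mult.commute)
    then show "\<phi> y \<in> U" using e by blast
  qed
qed auto

lemma ell1_normed_subspace: "normed_subspace ell1 ell1_norm"
proof
  show "subspace ell1"
    unfolding subspace_def ell1_def
  proof (safe, goal_cases)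
    case (2 x y)
    show ?case
      by (rule summable_comparison_test'[OF summable_add[OF 2]]) (auto simp: abs_triangle_ineq)
  qed (auto simp: scaleR_fun_def abs_mult zero_fun_def summable_mult)
  show "norm_on ell1 ell1_norm"
    unfolding norm_on_def
  proof (intro conjI ballI allI)
    fix x assume "x \<in> ell1"
    then have x: "summable (\<lambda>n. \<bar>x n\<bar>)" by (simp add: ell1_def)
    show "0 \<le> ell1_norm x"
      unfolding ell1_norm_def by (intro suminf_nonneg x) auto
    show "ell1_norm x = 0 \<longleftrightarrow> x = 0"
      unfolding ell1_norm_def by (subst suminf_eq_zero_iff[OF x]) (auto simp: fun_eq_iff)
    show "ell1_norm (c *\<^sub>R x) = \<bar>c\<bar> * ell1_norm x" for c
      unfolding ell1_norm_def by (simp add: scaleR_fun_def abs_mult suminf_mult[OF x])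
    fix y assume "y \<in> ell1"
    then have y: "summable (\<lambda>n. \<bar>y n\<bar>)" by (simp add: ell1_def)
    have "(\<Sum>n. \<bar>(x + y) n\<bar>) \<le> (\<Sum>n. \<bar>x n\<bar> + \<bar>y n\<bar>)"
      by (rule suminf_le[OF _ summable_comparison_test'[OF summable_add[OF x y]] summable_add[OF x y]])
        (auto simp: abs_triangle_ineq)
    then show "ell1_norm (x + y) \<le> ell1_norm x + ell1_norm y"
      unfolding ell1_norm_def by (simp add: suminf_add[OF x y])
  qed
qed

interpretation ell1: normed_subspace ell1 ell1_norm
  by (rule ell1_normed_subspace)

lemma summable_ell1: "x \<in> ell1 \<Longrightarrow> summable (\<lambda>n. \<bar>x n\<bar>)"
  by (simp add: ell1_def)

lemma sum_abs_le_ell1_norm: "x \<in> ell1 \<Longrightarrow> finite J \<Longrightarrow> (\<Sum>n\<in>J. \<bar>x n\<bar>) \<le> ell1_norm x"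
  unfolding ell1_norm_def by (rule sum_le_suminf) (auto simp: ell1_def)

lemma abs_le_ell1_norm: "x \<in> ell1 \<Longrightarrow> \<bar>x n\<bar> \<le> ell1_norm x"
  using sum_abs_le_ell1_norm[of x "{n}"] by simp

lemma ell1_finite_support:
  assumes "\<And>j. n < j \<Longrightarrow> x j = 0"
  shows "x \<in> ell1" and "ell1_norm x = (\<Sum>j\<le>n. \<bar>x j\<bar>)"
proof -
  have "(\<lambda>j. \<bar>x j\<bar>) sums (\<Sum>j\<le>n. \<bar>x j\<bar>)"
    by (rule sums_finite) (auto intro: assms)
  then show "x \<in> ell1" "ell1_norm x = (\<Sum>j\<le>n. \<bar>x j\<bar>)"
    by (auto simp: ell1_def ell1_norm_def sums_iff)
qed

lemma ell1_mcomplete: "Metric_space.mcomplete ell1 (norm_dist ell1 ell1_norm)"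
  unfolding ell1.metric.mcomplete_def
proof (intro allI impI)
  fix \<sigma> assume "ell1.metric.MCauchy \<sigma>"
  then have mem: "\<sigma> n \<in> ell1"
    and cauchy: "\<And>e. 0 < e \<Longrightarrow> \<exists>M. \<forall>n n'. M \<le> n \<longrightarrow> M \<le> n' \<longrightarrow> ell1_norm (\<sigma> n - \<sigma> n') < e" for n
    unfolding ell1.metric.MCauchy_def by (auto simp: norm_dist_def range_subsetD)
  have "Cauchy (\<lambda>n. \<sigma> n k)" for k
    unfolding Cauchy_def
  proof (intro allI impI)
    fix e :: real assume "0 < e"
    then obtain M where M: "\<And>n n'. M \<le> n \<Longrightarrow> M \<le> n' \<Longrightarrow> ell1_norm (\<sigma> n - \<sigma> n') < e"
      using cauchy by blast
    have "dist (\<sigma> n k) (\<sigma> n' k) < e" if "M \<le> n" "M \<le> n'" for n n'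
      using abs_le_ell1_norm[OF ell1.mem_diff[OF mem[of n] mem[of n']], of k] M[OF that]
      by (simp add: dist_real_def)
    then show "\<exists>M. \<forall>m\<ge>M. \<forall>n\<ge>M. dist (\<sigma> m k) (\<sigma> n k) < e" by blast
  qed
  then have "\<exists>l. (\<lambda>n. \<sigma> n k) \<longlonglongrightarrow> l" for k
    using Cauchy_convergent convergent_def by blast
  then obtain x where x: "\<And>k. (\<lambda>n. \<sigma> n k) \<longlonglongrightarrow> x k" by metis
  have close: "\<exists>M. \<forall>n\<ge>M. \<sigma> n - x \<in> ell1 \<and> ell1_norm (\<sigma> n - x) \<le> e" if e: "0 < e" for e
  proof -
    obtain M where M: "\<And>n n'. M \<le> n \<Longrightarrow> M \<le> n' \<Longrightarrow> ell1_norm (\<sigma> n - \<sigma> n') < e"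
      using cauchy[OF e] by blast
    have "\<sigma> n - x \<in> ell1 \<and> ell1_norm (\<sigma> n - x) \<le> e" if n: "M \<le> n" for n
    proof -
      have le: "(\<Sum>k<K. \<bar>(\<sigma> n - x) k\<bar>) \<le> e" for K
      proof (rule LIMSEQ_le_const2)
        show "(\<lambda>n'. \<Sum>k<K. \<bar>\<sigma> n k - \<sigma> n' k\<bar>) \<longlonglongrightarrow> (\<Sum>k<K. \<bar>(\<sigma> n - x) k\<bar>)"
          by (auto intro!: tendsto_intros x)
        have "(\<Sum>k<K. \<bar>\<sigma> n k - \<sigma> n' k\<bar>) \<le> e" if "M \<le> n'" for n'
          using sum_abs_le_ell1_norm[OF ell1.mem_diff[OF mem[of n] mem[of n']], of "{..<K}"] M[OF n that]
          by simp
        then show "\<exists>M. \<forall>n'\<ge>M. (\<Sum>k<K. \<bar>\<sigma> n k - \<sigma> n' k\<bar>) \<le> e" by blast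
      qed
      have sm: "summable (\<lambda>k. \<bar>(\<sigma> n - x) k\<bar>)"
        by (rule summableI_nonneg_bounded[OF _ le]) simp
      then show ?thesis
        using suminf_le_const[OF sm le] by (simp add: ell1_def ell1_norm_def)
    qed
    then show ?thesis by blast
  qed
  obtain n where "\<sigma> n - x \<in> ell1"
    using close[of 1] by auto
  then have xm: "x \<in> ell1"
    using ell1.mem_diff[OF mem[of n]] by fastforce
  have "limitin (norm_topology ell1 ell1_norm) \<sigma> x sequentially"
    unfolding ell1.limitin_iff eventually_sequentially
  proof (intro conjI allI impI xm)
    fix e :: real assume "0 < e"
    then obtain M where "\<forall>n\<ge>M. ell1_norm (\<sigma> n - x) \<le> e / 2"
      using close[of "e / 2"] by auto
    then have "\<forall>n\<ge>M. \<sigma> n \<in> ell1 \<and> ell1_norm (\<sigma> n - x) < e"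
      using mem \<open>0 < e\<close> by (fastforce intro: le_less_trans)
    then show "\<exists>M. \<forall>n\<ge>M. \<sigma> n \<in> ell1 \<and> ell1_norm (\<sigma> n - x) < e" by blast
  qed
  then show "\<exists>x. limitin ell1.metric.mtopology \<sigma> x sequentially"
    by (auto simp: norm_topology_def)
qed

lemma ell1_banach: "banach_space_on ell1 ell1_norm"
  unfolding banach_space_on_def using ell1.subspace ell1.norm ell1_mcomplete by blast

definition unit_vec :: "nat \<Rightarrow> nat \<Rightarrow> real" where
  "unit_vec k = (\<lambda>j. if j = k then 1 else 0)"

lemma sum_fun_apply: "(\<Sum>i\<in>A. f i) x = (\<Sum>i\<in>A. f i x)" for f :: "'i \<Rightarrow> 'x \<Rightarrow> real"
  by (induction A rule: infinite_finite_induct) auto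

lemma unit_vec_ell1: "unit_vec k \<in> ell1" and norm_unit_vec: "ell1_norm (unit_vec k) = 1"
proof -
  have zero: "unit_vec k j = 0" if "k < j" for j
    using that by (simp add: unit_vec_def)
  show "unit_vec k \<in> ell1"
    by (rule ell1_finite_support(1)[OF zero])
  have abs: "\<bar>unit_vec k j\<bar> = (if j = k then 1 else 0)" for j
    by (simp add: unit_vec_def)
  show "ell1_norm (unit_vec k) = 1"
    by (subst ell1_finite_support(2)[OF zero]) (auto simp: abs)
qed

lemma ell1_infinite_dimensional: "infinite_dimensional ell1"
  unfolding infinite_dimensional_def
proof
  have inj: "inj unit_vec"
    by (rule injI) (metis unit_vec_def zero_neq_one)
  have "independent (range unit_vec)"
    unfolding independent_explicit_finite_subsets
  proof (intro allI impI ballI)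
    fix T :: "(nat \<Rightarrow> real) set" and c v
    assume T: "T \<subseteq> range unit_vec" "finite T" "(\<Sum>w\<in>T. c w *\<^sub>R w) = 0" "v \<in> T"
    then obtain k where k: "v = unit_vec k" by auto
    have coeff: "w k = (if w = v then 1 else 0)" if w: "w \<in> T" for w
    proof -
      obtain j where j: "w = unit_vec j" using w T(1) by auto
      then have "w = v \<longleftrightarrow> j = k" using inj by (simp add: k inj_eq)
      then show ?thesis by (auto simp: j unit_vec_def)
    qed
    have "(\<Sum>w\<in>T. c w *\<^sub>R w) k = (\<Sum>w\<in>T. if w = v then c w else 0)"
      unfolding sum_fun_apply
    proof (rule sum.cong)
      show "(c w *\<^sub>R w) k = (if w = v then c w else 0)" if "w \<in> T" for w
        using coeff[OF that] by (simp add: scaleR_fun_def)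
    qed simp
    then show "c v = 0"
      using T by simp
  qed
  moreover assume "\<exists>B. finite B \<and> ell1 \<subseteq> span B"
  moreover have "range unit_vec \<subseteq> ell1"
    using unit_vec_ell1 by auto
  ultimately have "finite (range unit_vec)"
    using independent_span_bound by blast
  then show False
    using finite_imageD[OF _ inj] by simp
qed

section \<open>A filter basis with prescribed norms\<close>

text \<open>
  With \<open>u\<close> for \<open>zigzag\<close> and \<open>e\<close> for the unit vectors, the construction is \<open>u 0 = e 0\<close> and
  \<open>u (k + 1) = e (k + 1) - ratio k *\<^sub>R u k\<close>.  The vectors telescope: the partial sums operator is
  \<open>S n x = (\<Sum>k\<le>n. x k *\<^sub>R e k) + (ratio n * x (n + 1)) *\<^sub>R u n\<close>.  It fixes \<open>e 0, \<dots>, e n\<close>, sends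
  \<open>e (n + 1)\<close> to \<open>ratio n *\<^sub>R u n\<close> and kills the later unit vectors.  On \<open>\<ell>\<^sub>1\<close> the norm of an operator
  is the supremum of the norms of the images of the unit vectors, so \<open>ratio n\<close> is chosen to give the image of
  \<open>e (n + 1)\<close> the norm \<open>a n > 1\<close>.
\<close>

context
  fixes a :: "nat \<Rightarrow> real"
  assumes a_gt: "\<And>n. 1 < a n"
begin

primrec zigzag :: "nat \<Rightarrow> nat \<Rightarrow> real" where
  "zigzag 0 = unit_vec 0"
| "zigzag (Suc k) = unit_vec (Suc k) - (a k / ell1_norm (zigzag k)) *\<^sub>R zigzag k"

definition ratio :: "nat \<Rightarrow> real" where
  "ratio k = a k / ell1_norm (zigzag k)"

definition zigzag_coord :: "nat \<Rightarrow> (nat \<Rightarrow> real) \<Rightarrow> real" where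
  "zigzag_coord k x = x k + ratio k * x (Suc k)"

lemma zigzag_Suc: "zigzag (Suc k) j = unit_vec (Suc k) j - ratio k * zigzag k j"
  by (simp add: ratio_def scaleR_fun_def)

lemma zigzag_support: "k < j \<Longrightarrow> zigzag k j = 0"
proof (induction k)
  case (Suc k)
  then show ?case by (simp only: zigzag_Suc) (simp add: unit_vec_def)
qed (simp add: unit_vec_def)

lemma zigzag_ell1: "zigzag k \<in> ell1"
  by (rule ell1_finite_support(1)[of k]) (rule zigzag_support)

lemma zigzag_diag: "zigzag k k = 1"
proof (cases k)
  case (Suc i)
  then show ?thesis by (simp only: zigzag_Suc) (simp add: zigzag_support unit_vec_def)
qed (simp add: unit_vec_def)

lemma norm_zigzag_pos: "0 < ell1_norm (zigzag k)"
  using abs_le_ell1_norm[OF zigzag_ell1, of k k] by (simp add: zigzag_diag)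

lemma ratio_pos: "0 < ratio k"
  using a_gt[of k] norm_zigzag_pos[of k] by (simp add: ratio_def)

lemma ratio_norm: "ratio k * ell1_norm (zigzag k) = a k"
  using norm_zigzag_pos[of k] by (simp add: ratio_def)

text \<open>
  For \<open>k = m + 1\<close> the two terms of the coordinate functional cancel; for larger \<open>k\<close> the recursion
  propagates the zero.
\<close>

lemma zigzag_biorthogonal: "zigzag_coord m (zigzag k) = (if k = m then 1 else 0)"
proof (induction k)
  case 0
  show ?case by (simp add: zigzag_coord_def unit_vec_def)
next
  case (Suc k)
  have "zigzag_coord m (zigzag (Suc k)) = zigzag_coord m (unit_vec (Suc k)) - ratio k * zigzag_coord m (zigzag k)"
    by (simp only: zigzag_coord_def zigzag_Suc) (simp add: algebra_simps)
  then show ?case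
    by (simp only: Suc.IH) (auto simp: zigzag_coord_def unit_vec_def)
qed

lemma zigzag_coord_sum: "zigzag_coord m (\<Sum>k\<in>A. c k *\<^sub>R v k) = (\<Sum>k\<in>A. c k * zigzag_coord m (v k))"
  by (simp add: zigzag_coord_def sum_fun_apply scaleR_fun_def sum.distrib sum_distrib_left algebra_simps)

lemma zigzag_coord_lipschitz:
  assumes "x \<in> ell1" "y \<in> ell1"
  shows "\<bar>zigzag_coord m x - zigzag_coord m y\<bar> \<le> (1 + ratio m) * ell1_norm (x - y)"
proof -
  have d: "x - y \<in> ell1" using assms by (rule ell1.mem_diff)
  have "zigzag_coord m x - zigzag_coord m y = (x - y) m + ratio m * (x - y) (Suc m)"
    by (simp add: zigzag_coord_def algebra_simps)
  also have "\<bar>\<dots>\<bar> \<le> \<bar>(x - y) m\<bar> + ratio m * \<bar>(x - y) (Suc m)\<bar>"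
    using ratio_pos[of m] by (intro order_trans[OF abs_triangle_ineq]) (simp add: abs_mult)
  also have "\<dots> \<le> ell1_norm (x - y) + ratio m * ell1_norm (x - y)"
    using ratio_pos[of m] by (intro add_mono mult_left_mono abs_le_ell1_norm d) auto
  finally show ?thesis by (simp add: algebra_simps)
qed

lemma zigzag_partial_sum:
  "(\<Sum>k\<le>n. zigzag_coord k x *\<^sub>R zigzag k) j
     = (if j \<le> n then x j else 0) + ratio n * x (Suc n) * zigzag n j"
proof (induction n)
  case 0
  show ?case by (simp add: scaleR_fun_def zigzag_coord_def unit_vec_def)
next
  case (Suc n)
  have "(\<Sum>k\<le>Suc n. zigzag_coord k x *\<^sub>R zigzag k) j
      = (\<Sum>k\<le>n. zigzag_coord k x *\<^sub>R zigzag k) j + zigzag_coord (Suc n) x * zigzag (Suc n) j"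
    by (simp add: scaleR_fun_def del: zigzag.simps)
  also have "\<dots> = (if j \<le> n then x j else 0) + ratio n * x (Suc n) * zigzag n j
      + x (Suc n) * zigzag (Suc n) j + ratio (Suc n) * x (Suc (Suc n)) * zigzag (Suc n) j"
    by (simp only: Suc.IH) (simp add: zigzag_coord_def algebra_simps del: zigzag.simps)
  also have "x (Suc n) * zigzag (Suc n) j = x (Suc n) * unit_vec (Suc n) j - ratio n * x (Suc n) * zigzag n j"
    by (simp only: zigzag_Suc) (simp add: algebra_simps)
  finally show ?case
    by (auto simp: unit_vec_def le_Suc_eq simp del: zigzag.simps)
qed

lemma abs_zigzag_term: "(\<Sum>j\<le>n. \<bar>ratio n * t * zigzag n j\<bar>) = a n * \<bar>t\<bar>"
proof -
  have "(\<Sum>j\<le>n. \<bar>ratio n * t * zigzag n j\<bar>) = ratio n * \<bar>t\<bar> * (\<Sum>j\<le>n. \<bar>zigzag n j\<bar>)"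
    using ratio_pos[of n] by (simp add: abs_mult sum_distrib_left)
  also have "(\<Sum>j\<le>n. \<bar>zigzag n j\<bar>) = ell1_norm (zigzag n)"
    using ell1_finite_support(2)[of n "zigzag n"] zigzag_support by simp
  finally show ?thesis
    using ratio_norm[of n] by (simp add: mult.assoc mult.left_commute mult.commute)
qed

lemma norm_zigzag_partial_sum_le:
  assumes x: "x \<in> ell1"
  shows "ell1_norm (\<Sum>k\<le>n. zigzag_coord k x *\<^sub>R zigzag k) \<le> a n * ell1_norm x"
proof -
  let ?S = "\<Sum>k\<le>n. zigzag_coord k x *\<^sub>R zigzag k"
  have "ell1_norm ?S = (\<Sum>j\<le>n. \<bar>?S j\<bar>)"
    by (rule ell1_finite_support(2)) (simp add: zigzag_partial_sum zigzag_support)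
  also have "\<dots> \<le> (\<Sum>j\<le>n. \<bar>x j\<bar> + \<bar>ratio n * x (Suc n) * zigzag n j\<bar>)"
    unfolding zigzag_partial_sum by (intro sum_mono) (auto simp: abs_triangle_ineq)
  also have "\<dots> = (\<Sum>j\<le>n. \<bar>x j\<bar>) + a n * \<bar>x (Suc n)\<bar>"
    by (simp add: sum.distrib abs_zigzag_term)
  also have "\<dots> \<le> a n * (\<Sum>j\<le>n. \<bar>x j\<bar>) + a n * \<bar>x (Suc n)\<bar>"
    using a_gt[of n] mult_right_mono[of 1 "a n" "\<Sum>j\<le>n. \<bar>x j\<bar>"] by (simp add: sum_nonneg)
  also have "\<dots> = a n * (\<Sum>j\<le>Suc n. \<bar>x j\<bar>)"
    by (simp add: algebra_simps)
  also have "\<dots> \<le> a n * ell1_norm x"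
    using a_gt[of n] by (intro mult_left_mono sum_abs_le_ell1_norm x) auto
  finally show ?thesis .
qed

lemma norm_zigzag_partial_sum_unit_vec:
  "ell1_norm (\<Sum>k\<le>n. zigzag_coord k (unit_vec (Suc n)) *\<^sub>R zigzag k) = a n"
proof -
  let ?S = "\<Sum>k\<le>n. zigzag_coord k (unit_vec (Suc n)) *\<^sub>R zigzag k"
  have eq: "?S j = ratio n * 1 * zigzag n j" for j
    unfolding zigzag_partial_sum by (simp add: unit_vec_def)
  have "ell1_norm ?S = (\<Sum>j\<le>n. \<bar>?S j\<bar>)"
    by (rule ell1_finite_support(2)) (simp add: eq zigzag_support)
  also have "\<dots> = a n * \<bar>1\<bar>"
    unfolding eq by (rule abs_zigzag_term)
  finally show ?thesis by simp
qed

lemma norm_zigzag_remainder_le: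
  assumes x: "x \<in> ell1"
  shows "ell1_norm ((\<Sum>k\<le>n. zigzag_coord k x *\<^sub>R zigzag k) - x)
    \<le> (\<Sum>j. \<bar>x (j + Suc n)\<bar>) + a n * \<bar>x (Suc n)\<bar>"
proof -
  let ?S = "\<Sum>k\<le>n. zigzag_coord k x *\<^sub>R zigzag k"
  have S: "?S \<in> ell1"
    by (rule ell1_finite_support(1)[of n]) (simp add: zigzag_partial_sum zigzag_support)
  have "ell1_norm (?S - x) = (\<Sum>j. \<bar>(?S - x) (j + Suc n)\<bar>) + (\<Sum>j<Suc n. \<bar>(?S - x) j\<bar>)"
    unfolding ell1_norm_def
    by (rule suminf_split_initial_segment[OF summable_ell1[OF ell1.mem_diff[OF S x]]])
  also have "(\<Sum>j. \<bar>(?S - x) (j + Suc n)\<bar>) = (\<Sum>j. \<bar>x (j + Suc n)\<bar>)"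
    by (simp add: zigzag_partial_sum zigzag_support)
  also have "(\<Sum>j<Suc n. \<bar>(?S - x) j\<bar>) = (\<Sum>j\<le>n. \<bar>ratio n * x (Suc n) * zigzag n j\<bar>)"
    unfolding lessThan_Suc_atMost by (intro sum.cong) (auto simp: zigzag_partial_sum)
  finally show ?thesis by (simp only: abs_zigzag_term order_refl)
qed

text \<open>
  Admissibility enters here.  On the set \<open>I\<close> where \<open>a n * |x (n + 1)| \<ge> e\<close>, the series of \<open>1 / a n\<close>
  is dominated by that of \<open>|x (n + 1)| / e\<close> and hence converges.  So \<open>I\<close> is not stationary, which means
  that its complement contains a member of the filter.
\<close>

lemma eventually_scaled_coefficient_less:
  assumes adm: "admissible1 F a" and x: "x \<in> ell1" and e: "0 < e"
  shows "\<forall>\<^sub>F n in F. a n * \<bar>x (Suc n)\<bar> < e"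
proof -
  define I where "I = {n. e \<le> a n * \<bar>x (Suc n)\<bar>}"
  have "(\<Sum>\<^sub>\<infinity>n\<in>I. ennreal (inverse (a n))) \<le> ennreal (ell1_norm x / e)"
  proof (rule infsum_le_finite_sums)
    show "(\<lambda>n. ennreal (inverse (a n))) summable_on I"
      by (rule nonneg_summable_on_complete) simp
    fix J assume J: "finite J" "J \<subseteq> I"
    have "(\<Sum>n\<in>J. inverse (a n)) \<le> (\<Sum>n\<in>J. \<bar>x (Suc n)\<bar> / e)"
    proof (rule sum_mono)
      fix n assume "n \<in> J"
      then have "e \<le> a n * \<bar>x (Suc n)\<bar>" using J by (auto simp: I_def)
      then show "inverse (a n) \<le> \<bar>x (Suc n)\<bar> / e"
        using e a_gt[of n] by (simp add: field_simps)
    qed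
    also have "\<dots> = (\<Sum>n\<in>Suc ` J. \<bar>x n\<bar>) / e"
      by (simp add: sum.reindex sum_divide_distrib)
    also have "\<dots> \<le> ell1_norm x / e"
      using e J by (intro divide_right_mono sum_abs_le_ell1_norm x) auto
    finally have "ennreal (\<Sum>n\<in>J. inverse (a n)) \<le> ennreal (ell1_norm x / e)"
      by (rule ennreal_leI)
    moreover have "(\<Sum>n\<in>J. ennreal (inverse (a n))) = ennreal (\<Sum>n\<in>J. inverse (a n))"
      using a_gt by (intro sum_ennreal) (simp add: less_imp_le order.trans[OF zero_le_one])
    ultimately show "(\<Sum>n\<in>J. ennreal (inverse (a n))) \<le> ennreal (ell1_norm x / e)"
      by simp
  qed
  then have "(\<Sum>\<^sub>\<infinity>n\<in>I. ennreal (inverse (a n))) \<noteq> \<infinity>"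
    by (auto simp: top_unique)
  then have "\<not> stationary F I"
    using adm unfolding admissible1_def by blast
  then obtain A where A: "\<forall>\<^sub>F n in F. n \<in> A" "I \<inter> A = {}"
    unfolding stationary_def by blast
  have "a n * \<bar>x (Suc n)\<bar> < e" if "n \<in> A" for n
  proof -
    have "n \<notin> I" using that A(2) by blast
    then show ?thesis by (simp add: I_def not_le)
  qed
  then show ?thesis
    using A(1) by (auto elim: eventually_mono)
qed

lemma f_expansion_zigzag:
  assumes free: "free_filter F" and adm: "admissible1 F a" and x: "x \<in> ell1"
  shows "f_expansion F ell1 ell1_norm zigzag x (\<lambda>k. zigzag_coord k x)"
  unfolding f_expansion_def ell1.limitin_iff
proof (intro conjI allI impI x)
  fix e :: real assume e: "0 < e"
  obtain m where m: "\<And>n. m \<le> n \<Longrightarrow> norm (\<Sum>j. \<bar>x (j + n)\<bar>) < e / 2"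
    using suminf_exist_split[OF _ summable_ell1[OF x], of "e / 2"] e by auto
  have "finite (- {m..})"
    by (rule finite_subset[of _ "{..<m}"]) auto
  then have "\<forall>\<^sub>F n in F. n \<in> {m..}"
    using free unfolding free_filter_def by blast
  moreover have "\<forall>\<^sub>F n in F. a n * \<bar>x (Suc n)\<bar> < e / 2"
    using e by (intro eventually_scaled_coefficient_less adm x) simp
  ultimately show "\<forall>\<^sub>F n in F. (\<Sum>k\<le>n. zigzag_coord k x *\<^sub>R zigzag k) \<in> ell1 \<and>
      ell1_norm ((\<Sum>k\<le>n. zigzag_coord k x *\<^sub>R zigzag k) - x) < e"
  proof eventually_elim
    case (elim n)
    have "(\<Sum>j. \<bar>x (j + Suc n)\<bar>) < e / 2"
      using m[of "Suc n"] elim by simp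
    then show ?case
      using norm_zigzag_remainder_le[OF x, of n] elim
      by (auto intro: ell1.mem_sum ell1.mem_scale zigzag_ell1)
  qed
qed

text \<open>
  For \<open>n \<ge> m\<close> the \<open>m\<close>-th coordinate functional takes the constant value \<open>c m\<close> on the partial sums, and
  it is continuous.
\<close>

lemma f_expansion_zigzag_unique:
  assumes free: "free_filter F" and x: "x \<in> ell1"
    and c: "f_expansion F ell1 ell1_norm zigzag x c"
  shows "c m = zigzag_coord m x"
proof (rule ccontr)
  assume ne: "c m \<noteq> zigzag_coord m x"
  define e where "e = \<bar>c m - zigzag_coord m x\<bar> / (1 + ratio m)"
  have r: "0 < 1 + ratio m" using ratio_pos[of m] by simp
  have "0 < e" using ne r by (simp add: e_def)
  then have "\<forall>\<^sub>F n in F. (\<Sum>k\<le>n. c k *\<^sub>R zigzag k) \<in> ell1 \<and> ell1_norm ((\<Sum>k\<le>n. c k *\<^sub>R zigzag k) - x) < e"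
    using c by (simp add: f_expansion_def ell1.limitin_iff)
  moreover have "\<forall>\<^sub>F n in F. n \<in> {m..}"
  proof -
    have "finite (- {m..})"
      by (rule finite_subset[of _ "{..<m}"]) auto
    then show ?thesis using free unfolding free_filter_def by blast
  qed
  ultimately have "\<forall>\<^sub>F n in F. False"
  proof eventually_elim
    case (elim n)
    have "zigzag_coord m (\<Sum>k\<le>n. c k *\<^sub>R zigzag k) = (\<Sum>k\<le>n. if k = m then c k else 0)"
      unfolding zigzag_coord_sum by (intro sum.cong) (auto simp: zigzag_biorthogonal)
    also have "\<dots> = c m"
      using elim by simp
    finally have "\<bar>c m - zigzag_coord m x\<bar> \<le> (1 + ratio m) * ell1_norm ((\<Sum>k\<le>n. c k *\<^sub>R zigzag k) - x)"
      using zigzag_coord_lipschitz[of "\<Sum>k\<le>n. c k *\<^sub>R zigzag k" x m] elim x by simp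
    also have "\<dots> < (1 + ratio m) * e"
      using elim r by (intro mult_strict_left_mono) auto
    also have "\<dots> = \<bar>c m - zigzag_coord m x\<bar>"
      using r by (simp add: e_def)
    finally show False by simp
  qed
  then show False
    using free by (simp add: free_filter_def eventually_False)
qed

lemma ell1_has_f_basis:
  assumes free: "free_filter F" and adm: "admissible1 F a"
  shows "has_f_basis_with_norms F a ell1 ell1_norm"
  unfolding has_f_basis_with_norms_def
proof (intro exI[of _ zigzag] conjI allI)
  have ex1: "\<exists>!c. f_expansion F ell1 ell1_norm zigzag x c" if "x \<in> ell1" for x
  proof (rule ex1I)
    show "f_expansion F ell1 ell1_norm zigzag x (\<lambda>k. zigzag_coord k x)"
      by (rule f_expansion_zigzag[OF free adm that])
    show "c = (\<lambda>k. zigzag_coord k x)" if "f_expansion F ell1 ell1_norm zigzag x c" for c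
      using f_expansion_zigzag_unique[OF free \<open>x \<in> ell1\<close> that] by (rule ext)
  qed
  then show "f_basis F ell1 ell1_norm zigzag"
    by (simp add: f_basis_def zigzag_ell1)
  have coord: "coord F ell1 ell1_norm zigzag k x = zigzag_coord k x" if "x \<in> ell1" for k x
  proof -
    have "(THE c. f_expansion F ell1 ell1_norm zigzag x c) = (\<lambda>k. zigzag_coord k x)"
      by (rule the1_equality[OF ex1[OF that]]) (rule f_expansion_zigzag[OF free adm that])
    then show ?thesis by (simp add: coord_def)
  qed
  show "continuous_map (norm_topology ell1 ell1_norm) euclideanreal (coord F ell1 ell1_norm zigzag k)" for k
    by (rule ell1.continuous_map_lipschitz[where B = "1 + ratio k"])
      (simp add: coord zigzag_coord_lipschitz)
  show "operator_norm ell1 ell1_norm (partial_sum_op F ell1 ell1_norm zigzag n) = a n" for n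
  proof -
    have S: "partial_sum_op F ell1 ell1_norm zigzag n x = (\<Sum>k\<le>n. zigzag_coord k x *\<^sub>R zigzag k)"
      if "x \<in> ell1" for x
      using that by (simp add: partial_sum_op_def coord)
    show ?thesis
      unfolding operator_norm_def
    proof (rule cSup_eq_maximum)
      show "a n \<in> (\<lambda>x. ell1_norm (partial_sum_op F ell1 ell1_norm zigzag n x)) ` {x \<in> ell1. ell1_norm x \<le> 1}"
        using norm_zigzag_partial_sum_unit_vec[of n]
        by (intro image_eqI[of _ _ "unit_vec (Suc n)"]) (auto simp: S unit_vec_ell1 norm_unit_vec)
      fix t assume "t \<in> (\<lambda>x. ell1_norm (partial_sum_op F ell1 ell1_norm zigzag n x)) ` {x \<in> ell1. ell1_norm x \<le> 1}"
      then obtain x where x: "x \<in> ell1" "ell1_norm x \<le> 1"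
        and t: "t = ell1_norm (\<Sum>k\<le>n. zigzag_coord k x *\<^sub>R zigzag k)"
        by (auto simp: S)
      have "a n * ell1_norm x \<le> a n * 1"
        using a_gt[of n] x by (intro mult_left_mono) auto
      then show "t \<le> a n"
        using norm_zigzag_partial_sum_le[OF x(1), of n] t by simp
    qed
  qed
qed

end

section \<open>The equivalence\<close>

lemma admissible_of_f_basis:
  assumes free: "free_filter F" and a: "\<And>n. 0 < a n"
    and banach: "banach_space_on V N" and has: "has_f_basis_with_norms F a V N"
  shows "admissible1 F a"
proof -
  obtain u where u: "f_basis F V N u"
    "\<And>k. continuous_map (norm_topology V N) euclideanreal (coord F V N u k)"
    "\<And>n. operator_norm V N (partial_sum_op F V N u n) = a n"
    using has unfolding has_f_basis_with_norms_def by blast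
  interpret continuous_f_basis V N F u
    using banach u(1,2) by unfold_locales (auto simp: banach_space_on_def)
  show ?thesis
    using banach unfolding banach_space_on_def by (intro admissible_of_norms free a u(3)) blast
qed

theorem theorem4p5:
  fixes F :: "nat filter" and a :: "nat \<Rightarrow> real"
  assumes "free_filter F" and "\<And>n. 1 < a n"
  shows "(has_f_basis_with_norms F a ell1 ell1_norm \<longleftrightarrow>
           (\<exists>(V :: (nat \<Rightarrow> real) set) N. banach_space_on V N \<and> infinite_dimensional V \<and>
              has_f_basis_with_norms F a V N)) \<and>
         ((\<exists>(V :: (nat \<Rightarrow> real) set) N. banach_space_on V N \<and> infinite_dimensional V \<and>
              has_f_basis_with_norms F a V N) \<longleftrightarrow> admissible1 F a) \<and>
         ((\<exists>(V :: 'b::real_vector set) N. banach_space_on V N \<and> infinite_dimensional V \<and>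
              has_f_basis_with_norms F a V N) \<longrightarrow> admissible1 F a)"
proof -
  have pos: "0 < a n" for n
    using assms(2)[of n] by simp
  have "has_f_basis_with_norms F a ell1 ell1_norm" if "admissible1 F a"
    by (rule ell1_has_f_basis[OF assms(2,1) that])
  then show ?thesis
    using admissible_of_f_basis[where 'a = "nat \<Rightarrow> real" and a = a, OF assms(1) pos]
      admissible_of_f_basis[where 'a = 'b and a = a, OF assms(1) pos] ell1_banach ell1_infinite_dimensional
    by blast
qed

end
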